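(* Let $F_2$ be the free group of rank $2$. There exists an algorithm that decides, for any two given elements $u, v \in F_2$, whether or not $u$ and $v$ are translation equivalent in $F_2$.
   Context: For $w \in F_2$ (with a fixed free basis), the cyclic length $\|w\|$ is the length of a cyclically reduced word conjugate to $w$. Two elements $u, v \in F_2$ are called translation equivalent in $F_2$ if $\|\phi(u)\| = \|\phi(v)\|$ for every automorphism $\phi$ of $F_2$. *)

theory Defs
  imports Main "HOL-Library.Nat_Bijection"
begin

datatype gen = GA | GB

text \<open>A letter is a generator with a flag; True means the inverse of the generator.\<close>
type_synonym letter = "gen \<times> bool"

definition inv_l :: "letter \<Rightarrow> letter" where
  "inv_l x = (fst x, \<not> snd x)"

definition reduced :: "letter list \<Rightarrow> bool" where
  "reduced w = successively (\<lambda>x y. y \<noteq> inv_l x) w"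

definition F2 :: "letter list set" where
  "F2 = {w. reduced w}"

fun cons_red :: "letter \<Rightarrow> letter list \<Rightarrow> letter list" where
  "cons_red x [] = [x]"
| "cons_red x (y # ys) = (if y = inv_l x then ys else x # y # ys)"

definition reduce :: "letter list \<Rightarrow> letter list" where
  "reduce w = foldr cons_red w []"

definition fmult :: "letter list \<Rightarrow> letter list \<Rightarrow> letter list" where
  "fmult u v = reduce (u @ v)"

definition finv :: "letter list \<Rightarrow> letter list" where
  "finv w = rev (map inv_l w)"

definition cyclically_reduced :: "letter list \<Rightarrow> bool" where
  "cyclically_reduced w \<longleftrightarrow> reduced w \<and> (w \<noteq> [] \<longrightarrow> last w \<noteq> inv_l (hd w))"

definition cyc_len :: "letter list \<Rightarrow> nat" where
  "cyc_len w = (LEAST n. \<exists>g\<in>F2. cyclically_reduced (fmult (fmult g w) (finv g))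
                          \<and> n = length (fmult (fmult g w) (finv g)))"

definition is_aut :: "(letter list \<Rightarrow> letter list) \<Rightarrow> bool" where
  "is_aut \<phi> \<longleftrightarrow> bij_betw \<phi> F2 F2 \<and> (\<forall>u\<in>F2. \<forall>v\<in>F2. \<phi> (fmult u v) = fmult (\<phi> u) (\<phi> v))"

definition translation_equivalent :: "letter list \<Rightarrow> letter list \<Rightarrow> bool" where
  "translation_equivalent u v \<longleftrightarrow> (\<forall>\<phi>. is_aut \<phi> \<longrightarrow> cyc_len (\<phi> u) = cyc_len (\<phi> v))"

datatype recf = Zero | Succ | Proj nat | Comp recf "recf list" | Prec recf recf | Mn recf

inductive rec_eval :: "recf \<Rightarrow> nat list \<Rightarrow> nat \<Rightarrow> bool" where
  zero: "rec_eval Zero xs 0"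
| succ: "rec_eval Succ (x # xs) (Suc x)"
| proj: "i < length xs \<Longrightarrow> rec_eval (Proj i) xs (xs ! i)"
| comp: "list_all2 (\<lambda>g y. rec_eval g xs y) gs ys \<Longrightarrow> rec_eval f ys z \<Longrightarrow> rec_eval (Comp f gs) xs z"
| prec0: "rec_eval f xs y \<Longrightarrow> rec_eval (Prec f g) (0 # xs) y"
| precS: "rec_eval (Prec f g) (n # xs) y \<Longrightarrow> rec_eval g (n # y # xs) z
          \<Longrightarrow> rec_eval (Prec f g) (Suc n # xs) z"
| mn: "rec_eval f (n # xs) 0 \<Longrightarrow> (\<forall>m<n. \<exists>k. rec_eval f (m # xs) (Suc k))
       \<Longrightarrow> rec_eval (Mn f) xs n"
monos list_all2_mono

fun letter_code :: "letter \<Rightarrow> nat" where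
  "letter_code (GA, False) = 0"
| "letter_code (GA, True) = 1"
| "letter_code (GB, False) = 2"
| "letter_code (GB, True) = 3"

definition word_code :: "letter list \<Rightarrow> nat" where
  "word_code w = list_encode (map letter_code w)"

end

(* Up to inner automorphisms and signed permutations of the basis, an automorphism of F2 is a
   product of a sign change of b and a word in the positive Nielsen maps a -> ab and b -> ba, so
   only the cyclic lengths of the images under these matter.  For a cyclic word, let a turn be a
   cyclic factor ab^-1, b^-1 a, ba^-1 or a^-1 b.  A positive Nielsen map changes the numbers of
   letters a and b by amounts determined by these numbers and the number of turns, and it never
   creates turns.  Writing the cyclic word as a product of blocks a^(+-1) b^k, the map a -> ab
   just shifts the exponents k by -1, 0 or 1.  Hence turns are lost only where a run of one
   generator bounded by two turns gets used up, and a measure of linear size (turns plus the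
   longest such runs) either drops or the map has no influence on the later numbers of turns.
   Two words whose cyclic lengths agree on all products of linear length therefore agree on all
   products, and only finitely many automorphisms have to be tested. *)

theory Submission
  imports Defs
begin

section \<open>Free reduction and cyclic length\<close>

text \<open>Turns are visible in cyclic lengths. One Nielsen map lengthens a cyclic word by the
  number of one letter minus the turns, so adding both cases gives 3 |w| - |sg w| - |tu w| = 2
  turns. Equal lengths on products thus give equal turn numbers on products shorter by one map, and
  equal turn numbers propagate equal letter numbers. The obstacle is that the two maps interfere:
  using up the b^-1 in a b^-1 a joins two letters a and may lengthen runs that the other map
  consumes later. This growth is paid for by lost turns, two for each joined pair. If no turn is
  lost, equal letters a are separated instead, and all bounded runs of a shrink to length at most
  one. The reduction to Nielsen maps follows Nielsen's method. Each elementary change of the images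
  of the basis is moved into the argument word, and the maps "sign change, then positive product"
  are closed under this, up to maps that preserve cyclic length. Only conjugacy classes matter, so
  both images may be conjugated simultaneously. Finally |w w| - |w| computes the cyclic length of w,
  and a bound on codes of test products makes the search primitive recursive.\<close>

lemma inv_l_inv_l [simp]: "inv_l (inv_l x) = x"
  by (simp add: inv_l_def)

lemma inv_l_neq [simp]: "inv_l x \<noteq> x" "x \<noteq> inv_l x"
  by (simp_all add: inv_l_def prod_eq_iff)

lemma inv_l_eq_iff [simp]: "inv_l x = inv_l y \<longleftrightarrow> x = y"
  by (metis inv_l_inv_l)

lemma reduced_Nil [simp]: "reduced []"
  by (simp add: reduced_def)

lemma reduced_Cons: "reduced (x # w) \<longleftrightarrow> reduced w \<and> (w = [] \<or> hd w \<noteq> inv_l x)"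
  by (auto simp: reduced_def successively_Cons)

lemma reduced_append:
  "reduced (u @ v) \<longleftrightarrow> reduced u \<and> reduced v \<and> (u = [] \<or> v = [] \<or> hd v \<noteq> inv_l (last u))"
  by (auto simp: reduced_def successively_append_iff)

lemma finv_Nil [simp]: "finv [] = []"
  by (simp add: finv_def)

lemma finv_Cons [simp]: "finv (x # w) = finv w @ [inv_l x]"
  by (simp add: finv_def)

lemma finv_append [simp]: "finv (u @ v) = finv v @ finv u"
  by (simp add: finv_def)

lemma finv_finv [simp]: "finv (finv w) = w"
  by (induction w) auto

lemma length_finv [simp]: "length (finv w) = length w"
  by (simp add: finv_def)

lemma finv_eq_Nil [simp]: "finv w = [] \<longleftrightarrow> w = []"
  by (simp add: finv_def)

lemma reduced_finv [simp]: "reduced (finv w) \<longleftrightarrow> reduced w"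
proof -
  have *: "reduced (finv w)" if "reduced w" for w
    using that
  proof (induction w)
    case (Cons x w)
    then show ?case
      by (cases w) (auto simp: reduced_Cons reduced_append)
  qed simp
  show ?thesis
    using *[of w] *[of "finv w"] by auto
qed

lemma reduced_cons_red: "reduced w \<Longrightarrow> reduced (cons_red x w)"
  by (cases w) (auto simp: reduced_Cons)

lemma cons_red_inverse: "reduced w \<Longrightarrow> cons_red x (cons_red (inv_l x) w) = w"
proof (induction w)
  case (Cons y w)
  then show ?case
    by (cases w) (auto simp: reduced_Cons)
qed simp

lemma reduced_foldr: "reduced z \<Longrightarrow> reduced (foldr cons_red u z)"
  by (induction u) (auto simp: reduced_cons_red)

lemma reduced_reduce [simp]: "reduced (reduce w)"
  by (simp add: reduce_def reduced_foldr)

lemma reduce_reduced [simp]: "reduced w \<Longrightarrow> reduce w = w"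
proof (induction w)
  case (Cons x w)
  then show ?case
    by (cases w) (auto simp: reduce_def reduced_Cons)
qed (simp add: reduce_def)

lemma reduce_Nil [simp]: "reduce [] = []"
  by (simp add: reduce_def)

lemma reduce_Cons: "reduce (x # w) = cons_red x (reduce w)"
  by (simp add: reduce_def)

lemma reduce_append: "reduce (u @ v) = foldr cons_red u (reduce v)"
  by (simp add: reduce_def)

lemma foldr_cons_red_cons_red:
  "reduced z \<Longrightarrow> foldr cons_red (cons_red x u) z = cons_red x (foldr cons_red u z)"
  by (cases u) (auto simp: cons_red_inverse reduced_foldr)

text \<open>Van der Waerden's argument: letters act on reduced words through
  \<open>cons_red\<close>, and by \<open>cons_red_inverse\<close> inverse letters act as inverse
  permutations. Cancelling pairs act trivially, so a word and its reduction act alike; this makes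
  reduction compatible with concatenation.\<close>

lemma foldr_reduce: "reduced z \<Longrightarrow> foldr cons_red (reduce u) z = foldr cons_red u z"
  by (induction u) (auto simp: reduce_Cons foldr_cons_red_cons_red)

lemma reduce_reduce_left [simp]: "reduce (reduce u @ v) = reduce (u @ v)"
  by (simp add: reduce_append foldr_reduce)

lemma reduce_reduce_right [simp]: "reduce (u @ reduce v) = reduce (u @ v)"
  by (simp add: reduce_append)

lemma length_cons_red: "length (cons_red x w) \<le> Suc (length w)"
  by (cases w) auto

lemma length_reduce: "length (reduce w) \<le> length w"
proof (induction w)
  case (Cons x w)
  then show ?case
    using length_cons_red[of x "reduce w"] by (simp add: reduce_Cons)
qed simp

section \<open>Equality and conjugacy in the free group, for unreduced words\<close>

definition freq :: "letter list \<Rightarrow> letter list \<Rightarrow> bool" (infix "\<approx>" 50) where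
  "u \<approx> v \<longleftrightarrow> reduce u = reduce v"

lemma freq_refl [simp]: "u \<approx> u"
  by (simp add: freq_def)

lemma freq_sym: "u \<approx> v \<Longrightarrow> v \<approx> u"
  by (simp add: freq_def)

lemma freq_trans [trans]: "u \<approx> v \<Longrightarrow> v \<approx> w \<Longrightarrow> u \<approx> w"
  by (simp add: freq_def)

lemma freq_append: "u \<approx> u' \<Longrightarrow> v \<approx> v' \<Longrightarrow> u @ v \<approx> u' @ v'"
  unfolding freq_def by (metis reduce_reduce_left reduce_reduce_right)

lemma freq_reduce [simp]: "reduce w \<approx> w"
  by (simp add: freq_def)

lemma freq_cancel: "x # inv_l x # w \<approx> w"
  by (simp add: freq_def reduce_Cons cons_red_inverse)

lemma freq_finv_right: "w @ finv w \<approx> []"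
proof (induction w)
  case (Cons x w)
  have "(x # w) @ finv (x # w) = [x] @ (w @ finv w) @ [inv_l x]"
    by simp
  also have "\<dots> \<approx> [x] @ [] @ [inv_l x]"
    using Cons by (intro freq_append) auto
  also have "\<dots> \<approx> []"
    using freq_cancel[of x "[]"] by simp
  finally show ?case .
qed simp

lemma freq_finv_left: "finv w @ w \<approx> []"
  using freq_finv_right[of "finv w"] by simp

lemma freq_mid_finv_right: "u @ w @ finv w @ v \<approx> u @ v"
proof -
  have "u @ (w @ finv w) @ v \<approx> u @ [] @ v"
    by (intro freq_append freq_finv_right) auto
  then show ?thesis by simp
qed

lemma freq_mid_finv_left: "u @ finv w @ w @ v \<approx> u @ v"
  using freq_mid_finv_right[of u "finv w" v] by simp

lemma freq_finv: "u \<approx> v \<Longrightarrow> finv u \<approx> finv v"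
proof -
  assume a: "u \<approx> v"
  have "finv u \<approx> finv u @ v @ finv v"
    using freq_mid_finv_right[of "finv u" v "[]"] by (simp add: freq_sym)
  also have "\<dots> \<approx> finv u @ u @ finv v"
    using a by (intro freq_append freq_sym[OF a]) auto
  also have "\<dots> \<approx> finv v"
    using freq_mid_finv_left[of "[]" u "finv v"] by simp
  finally show ?thesis .
qed

lemma freq_move_right: "u @ v \<approx> w \<Longrightarrow> u \<approx> w @ finv v"
proof -
  assume "u @ v \<approx> w"
  then have "(u @ v) @ finv v \<approx> w @ finv v"
    by (intro freq_append) auto
  moreover have "u \<approx> (u @ v) @ finv v"
    using freq_mid_finv_right[of u v "[]"] by (simp add: freq_sym)
  ultimately show ?thesis
    using freq_trans by blast
qed

definition fconj :: "letter list \<Rightarrow> letter list \<Rightarrow> bool" (infix "\<sim>" 50) where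
  "u \<sim> v \<longleftrightarrow> (\<exists>g. u \<approx> g @ v @ finv g)"

lemma fconjI: "u \<approx> g @ v @ finv g \<Longrightarrow> u \<sim> v"
  by (auto simp: fconj_def)

lemma freq_imp_fconj: "u \<approx> v \<Longrightarrow> u \<sim> v"
  using fconjI[of u "[]" v] by simp

lemma fconj_refl [simp]: "u \<sim> u"
  by (simp add: freq_imp_fconj)

lemma fconj_sym: "u \<sim> v \<Longrightarrow> v \<sim> u"
proof -
  assume "u \<sim> v"
  then obtain g where g: "u \<approx> g @ v @ finv g"
    by (auto simp: fconj_def)
  have "finv g @ u @ finv (finv g) \<approx> finv g @ (g @ v @ finv g) @ finv (finv g)"
    using g by (intro freq_append) auto
  also have "\<dots> = [] @ finv g @ g @ (v @ finv g @ g)"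
    by simp
  also have "\<dots> \<approx> [] @ v @ finv g @ g"
    by (rule freq_mid_finv_left)
  also have "\<dots> \<approx> v"
    using freq_mid_finv_left[of v g "[]"] by simp
  finally show ?thesis
    by (rule fconjI[OF freq_sym])
qed

lemma fconj_trans [trans]: "u \<sim> v \<Longrightarrow> v \<sim> w \<Longrightarrow> u \<sim> w"
proof -
  assume "u \<sim> v" "v \<sim> w"
  then obtain g h where g: "u \<approx> g @ v @ finv g" and h: "v \<approx> h @ w @ finv h"
    by (auto simp: fconj_def)
  note g
  also have "g @ v @ finv g \<approx> g @ (h @ w @ finv h) @ finv g"
    using h by (intro freq_append) auto
  also have "\<dots> = (g @ h) @ w @ finv (g @ h)"
    by simp
  finally show ?thesis
    by (rule fconjI)
qed

lemma fconj_rotate: "u @ v \<sim> v @ u"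
proof (rule fconjI)
  show "u @ v \<approx> u @ (v @ u) @ finv u"
    using freq_mid_finv_right[of "u @ v" u "[]"] by (simp add: freq_sym)
qed

section \<open>Cyclically reduced conjugates and their length\<close>

lemma cyclically_reduced_Nil [simp]: "cyclically_reduced []"
  by (simp add: cyclically_reduced_def)

lemma cyclic_decomposition:
  assumes "reduced w"
  shows "\<exists>g c. w = g @ c @ finv g \<and> cyclically_reduced c"
  using assms
proof (induction "length w" arbitrary: w rule: less_induct)
  case less
  show ?case
  proof (cases "cyclically_reduced w")
    case True
    then show ?thesis
      by (intro exI[of _ "[]"] exI[of _ w]) auto
  next
    case False
    then have w: "w \<noteq> []" "last w = inv_l (hd w)"
      using less.prems by (auto simp: cyclically_reduced_def)
    then obtain x y where xy: "w = x # y"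
      by (cases w) auto
    with w have "y \<noteq> []"
      by (auto split: if_splits)
    then obtain z where z: "w = x # z @ [inv_l x]"
      using w xy by (metis append_butlast_last_id last.simps list.sel(1))
    then have "reduced z"
      using less.prems by (auto simp: reduced_Cons reduced_append)
    with less.hyps[of z] z obtain g c where "z = g @ c @ finv g" "cyclically_reduced c"
      by auto
    then show ?thesis
      using z by (intro exI[of _ "x # g"] exI[of _ c]) auto
  qed
qed

lemma exists_cyclically_reduced: "\<exists>c. cyclically_reduced c \<and> w \<sim> c"
proof -
  obtain g c where "reduce w = g @ c @ finv g" "cyclically_reduced c"
    using cyclic_decomposition[OF reduced_reduce] by blast
  then have "w \<approx> g @ c @ finv g"
    by (metis freq_reduce freq_sym)
  then show ?thesis
    using \<open>cyclically_reduced c\<close> fconjI by blast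
qed

lemma reduced_power:
  assumes "cyclically_reduced c"
  shows "reduced (concat (replicate n c))"
proof (cases "c = []")
  case False
  have c: "reduced c" "last c \<noteq> inv_l (hd c)"
    using assms False by (auto simp: cyclically_reduced_def)
  have hd: "hd (concat (replicate n c)) = hd c" if "concat (replicate n c) \<noteq> []" for n
    using that False by (cases n) auto
  have "hd c \<noteq> inv_l (last c)"
    using c(2) by auto
  then show ?thesis
  proof (induction n)
    case (Suc n)
    then show ?case
      using c(1) hd[of n] by (auto simp: reduced_append simp del: concat_eq_Nil_conv)
  qed simp
qed simp

lemma power_fconj:
  assumes "u \<approx> g @ v @ finv g"
  shows "concat (replicate n u) \<approx> g @ concat (replicate n v) @ finv g"
proof (induction n)
  case 0
  then show ?case
    using freq_sym[OF freq_finv_right] by simp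
next
  case (Suc n)
  have "concat (replicate (Suc n) u) \<approx> (g @ v @ finv g) @ (g @ concat (replicate n v) @ finv g)"
    using freq_append[OF assms Suc] by simp
  also have "\<dots> = (g @ v) @ finv g @ g @ (concat (replicate n v) @ finv g)"
    by simp
  also have "\<dots> \<approx> (g @ v) @ (concat (replicate n v) @ finv g)"
    by (rule freq_mid_finv_left)
  finally show ?case
    by simp
qed

text \<open>Powers of a cyclically reduced word are reduced, so conjugation by a word of length
  k changes the n-th power by at most 2 k letters; let n tend to infinity.\<close>

lemma cyclically_reduced_length_le:
  assumes "cyclically_reduced c" "cyclically_reduced d" "c \<sim> d"
  shows "length c \<le> length d"
proof (rule ccontr)
  assume "\<not> length c \<le> length d"
  then have less: "length d + 1 \<le> length c"
    by simp
  obtain g where g: "c \<approx> g @ d @ finv g"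
    using assms by (auto simp: fconj_def)
  define n where "n = 2 * length g + 1"
  have len: "length (concat (replicate m w)) = m * length w" for m and w :: "letter list"
    by (induction m) auto
  have "n * length c = length (reduce (concat (replicate n c)))"
    using reduced_power[OF assms(1)] by (simp add: len)
  also have "\<dots> = length (reduce (g @ concat (replicate n d) @ finv g))"
    using power_fconj[OF g] by (simp add: freq_def)
  also have "\<dots> \<le> length (g @ concat (replicate n d) @ finv g)"
    by (rule length_reduce)
  also have "\<dots> = 2 * length g + n * length d"
    by (simp add: len)
  finally have "n * length c \<le> 2 * length g + n * length d" .
  moreover have "n * (length d + 1) \<le> n * length c"
    using less by (intro mult_left_mono) auto
  ultimately show False
    by (simp add: n_def)
qed

lemma fmult_conj: "fmult (fmult g w) (finv g) = reduce (g @ w @ finv g)"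
  by (simp add: fmult_def)

text \<open>Images under endomorphisms arise as unreduced words. Reducing first turns the cyclic
  length into a function on all words that depends on the conjugacy class only.\<close>

definition clen :: "letter list \<Rightarrow> nat" where
  "clen w = cyc_len (reduce w)"

text \<open>By \<open>cyclically_reduced_length_le\<close> no cyclically reduced conjugate is
  shorter than another, so every one of them attains the minimum in \<open>cyc_len\<close>.\<close>

lemma clen_eq:
  assumes "cyclically_reduced c" "w \<sim> c"
  shows "clen w = length c"
  unfolding clen_def cyc_len_def
proof (rule Least_equality)
  obtain g where g: "c \<approx> g @ w @ finv g"
    using fconj_sym[OF assms(2)] by (auto simp: fconj_def)
  \<comment> \<open>\<open>cyc_len\<close> admits only conjugators in \<open>F2\<close>, hence the
    passage from g to \<open>reduce g\<close>.\<close>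
  have "reduce (reduce g @ w @ finv (reduce g)) = reduce (g @ w @ finv g)"
    using freq_append[OF freq_reduce[of g] freq_append[OF freq_refl[of w] freq_finv[OF freq_reduce[of g]]]]
    by (simp add: freq_def)
  then have "reduce (reduce g @ reduce w @ finv (reduce g)) = c"
    using g assms(1) unfolding freq_def cyclically_reduced_def
    by (metis append.assoc reduce_reduce_left reduce_reduce_right reduce_reduced)
  then show "\<exists>g\<in>F2. cyclically_reduced (fmult (fmult g (reduce w)) (finv g)) \<and>
          length c = length (fmult (fmult g (reduce w)) (finv g))"
    using assms(1) by (intro bexI[of _ "reduce g"]) (simp_all add: fmult_conj F2_def del: reduce_reduce_left)
next
  fix n
  assume "\<exists>g\<in>F2. cyclically_reduced (fmult (fmult g (reduce w)) (finv g)) \<and>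
          n = length (fmult (fmult g (reduce w)) (finv g))"
  then obtain g where g: "cyclically_reduced (reduce (g @ reduce w @ finv g))"
    "n = length (reduce (g @ reduce w @ finv g))"
    by (auto simp: fmult_conj)
  have "reduce (g @ reduce w @ finv g) \<approx> g @ reduce w @ finv g"
    by simp
  then have "reduce (g @ reduce w @ finv g) \<sim> reduce w"
    by (rule fconjI)
  also have "reduce w \<sim> w"
    by (simp add: freq_imp_fconj)
  also note assms(2)
  finally have "c \<sim> reduce (g @ reduce w @ finv g)"
    by (rule fconj_sym)
  then show "length c \<le> n"
    using cyclically_reduced_length_le[OF assms(1) g(1)] g(2) by simp
qed

lemma clen_fconj: "u \<sim> v \<Longrightarrow> clen u = clen v"
  by (metis clen_eq exists_cyclically_reduced fconj_trans)

lemma clen_freq: "u \<approx> v \<Longrightarrow> clen u = clen v"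
  by (simp add: clen_fconj freq_imp_fconj)

lemma clen_F2: "w \<in> F2 \<Longrightarrow> clen w = cyc_len w"
  by (simp add: clen_def F2_def)

lemma clen_decomposition:
  obtains g c where "reduce w = g @ c @ finv g" "cyclically_reduced c" "w \<approx> g @ c @ finv g"
    "clen w = length c"
proof -
  obtain g c where w: "reduce w = g @ c @ finv g" and c: "cyclically_reduced c"
    using cyclic_decomposition[OF reduced_reduce] by blast
  have "w \<approx> g @ c @ finv g"
    unfolding w[symmetric] by (rule freq_sym) (rule freq_reduce)
  with w c that[of g c] clen_eq[OF c fconjI[of w g c]] show ?thesis
    by blast
qed

text \<open>For w = g c g^-1 with c cyclically reduced, w w = g c c g^-1 is again free of
  cancellation. This yields the cyclic length without a search for a conjugator, and it bounds the
  cancellation of a word with itself in the Nielsen argument.\<close>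

lemma clen_double: "length (reduce w) + clen w = length (reduce (w @ w))"
proof -
  obtain g c where w: "reduce w = g @ c @ finv g" and c: "cyclically_reduced c"
    and conj: "w \<approx> g @ c @ finv g" and len: "clen w = length c"
    by (rule clen_decomposition)
  have red: "reduced (g @ c @ finv g)"
    unfolding w[symmetric] by (rule reduced_reduce)
  have "w @ w \<approx> g @ (c @ c) @ finv g"
    using power_fconj[OF conj, of 2] by (simp add: numeral_2_eq_2)
  moreover have "reduced (g @ (c @ c) @ finv g)"
  proof (cases "c = []")
    case False
    have "reduced (c @ c)"
      using reduced_power[OF c, of 2] by (simp add: numeral_2_eq_2)
    with False red show ?thesis
      unfolding reduced_append by auto
  qed (use red in simp)
  ultimately have "reduce (w @ w) = g @ (c @ c) @ finv g"
    by (simp add: freq_def)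
  then show ?thesis
    unfolding len w by simp
qed

lemma clen_le: "clen w \<le> length w"
proof -
  obtain g c where w: "reduce w = g @ c @ finv g" and "cyclically_reduced c"
    "w \<approx> g @ c @ finv g" and len: "clen w = length c"
    by (rule clen_decomposition)
  have "length c \<le> length (reduce w)"
    unfolding w by simp
  then show ?thesis
    using length_reduce[of w] len by simp
qed

section \<open>Endomorphisms and block coordinates of cyclic words\<close>

fun letter_image :: "letter list \<Rightarrow> letter list \<Rightarrow> letter \<Rightarrow> letter list" where
  "letter_image x y (GA, s) = (if s then finv x else x)"
| "letter_image x y (GB, s) = (if s then finv y else y)"

definition ext :: "letter list \<Rightarrow> letter list \<Rightarrow> letter list \<Rightarrow> letter list" where
  "ext x y w = concat (map (letter_image x y) w)"

lemma letter_image_inv_l: "letter_image x y (inv_l l) = finv (letter_image x y l)"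
  by (cases "(x, y, l)" rule: letter_image.cases) (auto simp: inv_l_def)

lemma ext_Nil [simp]: "ext x y [] = []"
  by (simp add: ext_def)

lemma ext_Cons: "ext x y (l # w) = letter_image x y l @ ext x y w"
  by (simp add: ext_def)

lemma ext_append: "ext x y (u @ v) = ext x y u @ ext x y v"
  by (simp add: ext_def)

lemma ext_finv: "ext x y (finv w) = finv (ext x y w)"
  by (induction w) (auto simp: ext_Cons ext_append letter_image_inv_l)

text \<open>Composites have the same form, so identities between endomorphisms come down to the
  images of the two generators.\<close>

lemma ext_ext: "ext x y (ext x' y' w) = ext (ext x y x') (ext x y y') w"
proof (induction w)
  case (Cons l w)
  have "ext x y (letter_image x' y' l) = letter_image (ext x y x') (ext x y y') l"
    by (cases "(x', y', l)" rule: letter_image.cases) (auto simp: ext_finv)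
  then show ?case
    using Cons by (simp add: ext_Cons ext_append)
qed simp

lemma ext_id: "ext [(GA, False)] [(GB, False)] w = w"
proof (induction w)
  case (Cons l w)
  then show ?case
    by (cases "([]::letter list, []::letter list, l)" rule: letter_image.cases)
       (auto simp: ext_Cons inv_l_def)
qed simp

lemma ext_cons_red: "ext x y (cons_red l w) \<approx> ext x y (l # w)"
proof (cases w)
  case (Cons m v)
  show ?thesis
  proof (cases "m = inv_l l")
    case True
    have "ext x y (l # w) = [] @ letter_image x y l @ finv (letter_image x y l) @ ext x y v"
      using Cons True by (simp add: ext_Cons letter_image_inv_l)
    also have "\<dots> \<approx> [] @ ext x y v"
      by (rule freq_mid_finv_right)
    finally show ?thesis
      using Cons True by (simp add: freq_sym)
  qed (use Cons in simp)
qed simp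

lemma ext_reduce: "ext x y (reduce w) \<approx> ext x y w"
proof (induction w)
  case (Cons l w)
  have "ext x y (reduce (l # w)) \<approx> ext x y (l # reduce w)"
    by (simp add: reduce_Cons ext_cons_red)
  also have "\<dots> \<approx> ext x y (l # w)"
    unfolding ext_Cons using Cons by (intro freq_append) auto
  finally show ?case .
qed simp

lemma ext_freq: "u \<approx> v \<Longrightarrow> ext x y u \<approx> ext x y v"
  using ext_reduce[of x y u] ext_reduce[of x y v] by (simp add: freq_def)

lemma ext_fconj: "u \<sim> v \<Longrightarrow> ext x y u \<sim> ext x y v"
  unfolding fconj_def by (metis ext_append ext_finv ext_freq)

abbreviation "sg \<equiv> ext [(GA, False), (GB, False)] [(GB, False)]"
abbreviation "tu \<equiv> ext [(GA, False)] [(GB, False), (GA, False)]"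
abbreviation "fl \<equiv> ext [(GA, False)] [(GB, True)]"
abbreviation "sw \<equiv> ext [(GB, False)] [(GA, False)]"

section \<open>Counting local patterns in cyclic words\<close>

fun other :: "gen \<Rightarrow> gen" where
  "other GA = GB"
| "other GB = GA"

lemma other_other [simp]: "other (other g) = g" "other g \<noteq> g" "g \<noteq> other g"
  by (cases g; simp)+

text \<open>Two adjacent letters with different generators either have the same sign, or form
  a turn: the second is the turn of the first.\<close>

definition turn :: "letter \<Rightarrow> letter" where
  "turn x = (other (fst x), \<not> snd x)"

text \<open>Sums f over every letter together with its two neighbours, where l and r stand outside
  the word. Explicit outside letters make the sum additive under concatenation;
  \<open>ccount\<close> closes the word to a cycle by letting its own ends be these
  neighbours.\<close>

fun count3 :: "(letter \<Rightarrow> letter \<Rightarrow> letter \<Rightarrow> int) \<Rightarrow> letter \<Rightarrow> letter list \<Rightarrow> letter \<Rightarrow> int" where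
  "count3 f l [] r = 0"
| "count3 f l [x] r = f l x r"
| "count3 f l (x # y # w) r = f l x y + count3 f x (y # w) r"

definition ccount :: "(letter \<Rightarrow> letter \<Rightarrow> letter \<Rightarrow> int) \<Rightarrow> letter list \<Rightarrow> int" where
  "ccount f w = count3 f (last w) w (hd w)"

lemma count3_append:
  "u \<noteq> [] \<Longrightarrow> v \<noteq> [] \<Longrightarrow> count3 f l (u @ v) r = count3 f l u (hd v) + count3 f (last u) v r"
proof (induction f l u r rule: count3.induct)
  case (2 f l x r)
  then show ?case by (cases v) auto
qed auto

lemma ccount_rotate: "ccount f (u @ v) = ccount f (v @ u)"
  by (cases "u = []"; cases "v = []") (auto simp: ccount_def count3_append)

lemma count3_replicate:
  "count3 f l (replicate (Suc n) y) r =
     (if n = 0 then f l y r else f l y y + (int n - 1) * f y y y + f y y r)"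
proof (induction n arbitrary: l)
  case (Suc n)
  show ?case
    using Suc[of y] by (cases n) (auto simp: algebra_simps)
qed simp

section \<open>Cyclic words as products of blocks\<close>

definition bpow :: "int \<Rightarrow> letter list" where
  "bpow k = replicate (nat \<bar>k\<bar>) (GB, k < 0)"

lemma bpow_0 [simp]: "bpow 0 = []"
  by (simp add: bpow_def)

lemma bpow_eq_Nil [simp]: "bpow k = [] \<longleftrightarrow> k = 0"
  by (auto simp: bpow_def)

lemma hd_bpow: "k \<noteq> 0 \<Longrightarrow> hd (bpow k) = (GB, k < 0)"
  by (auto simp: bpow_def)

lemma last_bpow: "k \<noteq> 0 \<Longrightarrow> last (bpow k) = (GB, k < 0)"
  by (auto simp: bpow_def)

lemma reduced_bpow [simp]: "reduced (bpow k)"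
proof -
  have "reduced (replicate n x)" for n x
  proof (induction n)
    case (Suc n)
    then show ?case by (cases n) (auto simp: reduced_Cons)
  qed simp
  then show ?thesis by (simp add: bpow_def)
qed

lemma bpow_Suc: "(GB, False) # bpow k \<approx> bpow (k + 1)"
proof (cases "k \<ge> 0")
  case True
  then have "nat \<bar>k + 1\<bar> = Suc (nat \<bar>k\<bar>)"
    by auto
  then show ?thesis
    using True by (simp add: bpow_def)
next
  case False
  then have "nat \<bar>k\<bar> = Suc (nat \<bar>k + 1\<bar>)"
    by auto
  then have "bpow k = (GB, True) # replicate (nat \<bar>k + 1\<bar>) (GB, True)"
    using False by (simp add: bpow_def)
  moreover have "replicate (nat \<bar>k + 1\<bar>) (GB, True) = bpow (k + 1)"
    using False by (cases "k = -1") (auto simp: bpow_def)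
  ultimately have "(GB, False) # bpow k = (GB, False) # inv_l (GB, False) # bpow (k + 1)"
    by (simp add: inv_l_def)
  then show ?thesis
    using freq_cancel by metis
qed

lemma bpow_pred: "(GB, True) # bpow k \<approx> bpow (k - 1)"
proof -
  have "(GB, True) # bpow k = [(GB, True)] @ bpow ((k - 1) + 1)"
    by simp
  also have "\<dots> \<approx> [(GB, True)] @ (GB, False) # bpow (k - 1)"
    by (intro freq_append freq_refl freq_sym[OF bpow_Suc])
  also have "\<dots> \<approx> bpow (k - 1)"
    using freq_cancel[of "(GB, True)" "bpow (k - 1)"] by (simp add: inv_l_def)
  finally show ?thesis .
qed

lemma bpow_add: "bpow j @ bpow k \<approx> bpow (j + k)"
proof -
  have F: "replicate n (GB, False) @ bpow k \<approx> bpow (int n + k)" for n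
  proof (induction n)
    case (Suc n)
    have "replicate (Suc n) (GB, False) @ bpow k \<approx> [(GB, False)] @ bpow (int n + k)"
      using freq_append[OF freq_refl[of "[(GB, False)]"] Suc] by simp
    also have "\<dots> \<approx> bpow (int (Suc n) + k)"
      using bpow_Suc[of "int n + k"] by (simp add: algebra_simps)
    finally show ?case .
  qed simp
  have T: "replicate n (GB, True) @ bpow k \<approx> bpow (- int n + k)" for n
  proof (induction n)
    case (Suc n)
    have "replicate (Suc n) (GB, True) @ bpow k \<approx> [(GB, True)] @ bpow (- int n + k)"
      using freq_append[OF freq_refl[of "[(GB, True)]"] Suc] by simp
    also have "\<dots> \<approx> bpow (- int (Suc n) + k)"
      using bpow_pred[of "- int n + k"] by (simp add: algebra_simps)
    finally show ?case .
  qed simp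
  show ?thesis
    using F[of "nat \<bar>j\<bar>"] T[of "nat \<bar>j\<bar>"] by (cases "j < 0") (auto simp: bpow_def[of j])
qed

lemma finv_bpow: "finv (bpow k) = bpow (- k)"
  by (auto simp: finv_def bpow_def inv_l_def)

lemma sg_bpow: "sg (bpow k) = bpow k"
proof -
  have "sg (replicate n (GB, s)) = replicate n (GB, s)" for n s
    by (induction n) (auto simp: ext_Cons inv_l_def)
  then show ?thesis
    by (simp add: bpow_def)
qed

fun gword :: "(nat \<Rightarrow> bool) \<Rightarrow> (nat \<Rightarrow> int) \<Rightarrow> nat \<Rightarrow> letter list" where
  "gword e k 0 = []"
| "gword e k (Suc n) = gword e k n @ (GA, e n) # bpow (k n)"

text \<open>The cyclic word is the product of the blocks a^(e i) b^(k i), with indices modulo n.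
  Every letter a starts a block, so that sg acts on the exponents k alone.\<close>

definition coords :: "nat \<Rightarrow> (nat \<Rightarrow> bool) \<Rightarrow> (nat \<Rightarrow> int) \<Rightarrow> bool" where
  "coords n e k \<longleftrightarrow> n > 0 \<and> (\<forall>i. e (i + n) = e i) \<and> (\<forall>i. k (i + n) = k i) \<and>
     (\<forall>i. k i = 0 \<longrightarrow> e i = e (Suc i))"

text \<open>Left neighbour of the a-letter that opens block i + 1; \<open>gnext\<close> is the right
  neighbour of the one that opens block i. For exponent zero both are a-letters.\<close>

definition glast :: "(nat \<Rightarrow> bool) \<Rightarrow> (nat \<Rightarrow> int) \<Rightarrow> nat \<Rightarrow> letter" where
  "glast e k i = (if k i = 0 then (GA, e i) else (GB, k i < 0))"

definition gnext :: "(nat \<Rightarrow> bool) \<Rightarrow> (nat \<Rightarrow> int) \<Rightarrow> nat \<Rightarrow> letter" where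
  "gnext e k i = (if k i = 0 then (GA, e (Suc i)) else (GB, k i < 0))"

lemma gword_Suc_neq_Nil [simp]: "gword e k (Suc m) \<noteq> []"
  by simp

lemma hd_gword: "hd (gword e k (Suc m)) = (GA, e 0)"
proof (induction m)
  case (Suc m)
  have "gword e k (Suc (Suc m)) = gword e k (Suc m) @ (GA, e (Suc m)) # bpow (k (Suc m))"
    by simp
  then show ?case
    using Suc by (metis gword_Suc_neq_Nil hd_append2)
qed simp

lemma last_gword: "last (gword e k (Suc m)) = glast e k m"
  by (auto simp: glast_def last_bpow)

lemma reduced_gword:
  "reduced (gword e k (Suc m)) \<longleftrightarrow> (\<forall>i<m. k i = 0 \<longrightarrow> e i = e (Suc i))"
proof -
  have blk: "reduced ((GA, s) # bpow j)" for s j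
    by (cases "j = 0") (auto simp: reduced_Cons hd_bpow inv_l_def)
  show ?thesis
  proof (induction m)
    case 0
    then show ?case
      using blk by simp
  next
    case (Suc m)
    have "reduced (gword e k (Suc (Suc m))) \<longleftrightarrow>
        reduced (gword e k (Suc m)) \<and> (GA, e (Suc m)) \<noteq> inv_l (last (gword e k (Suc m)))"
      using reduced_append[of "gword e k (Suc m)" "(GA, e (Suc m)) # bpow (k (Suc m))"]
        gword.simps(2)[of e k "Suc m"]
      by (simp add: blk del: gword.simps)
    also have "\<dots> \<longleftrightarrow> reduced (gword e k (Suc m)) \<and> (k m = 0 \<longrightarrow> e m = e (Suc m))"
      unfolding last_gword by (auto simp: glast_def inv_l_def)
    finally show ?case
      using Suc by (auto simp: less_Suc_eq)
  qed
qed

lemma cyclically_reduced_gword: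
  assumes "e (Suc m) = e 0"
  shows "cyclically_reduced (gword e k (Suc m)) \<longleftrightarrow>
         (\<forall>i<Suc m. k i = 0 \<longrightarrow> e i = e (Suc i))"
  unfolding cyclically_reduced_def reduced_gword hd_gword last_gword
  using assms by (auto simp: glast_def inv_l_def less_Suc_eq)

lemma coords_cyclically_reduced: "coords n e k \<Longrightarrow> cyclically_reduced (gword e k n)"
proof (cases n)
  case (Suc m)
  assume *: "coords n e k"
  then have "e (0 + Suc m) = e 0"
    unfolding coords_def Suc by blast
  with * show ?thesis
    unfolding Suc by (subst cyclically_reduced_gword) (auto simp: coords_def)
qed (simp add: coords_def)

text \<open>Each block contributes the letters of its b-power and its opening a-letter. The first
  a-letter is kept apart because its left neighbour is the outside letter l.\<close>

lemma count3_gword: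
  "count3 f l (gword e k (Suc m)) (GA, e (Suc m)) =
     f l (GA, e 0) (gnext e k 0) +
     (\<Sum>i<Suc m. count3 f (GA, e i) (bpow (k i)) (GA, e (Suc i))) +
     (\<Sum>i<m. f (glast e k i) (GA, e (Suc i)) (gnext e k (Suc i)))"
proof -
  have blk: "count3 f l ((GA, e i) # bpow (k i)) (GA, e (Suc i)) =
      f l (GA, e i) (gnext e k i) + count3 f (GA, e i) (bpow (k i)) (GA, e (Suc i))" for l i
  proof (cases "k i = 0")
    case False
    then show ?thesis
      using count3_append[of "[(GA, e i)]" "bpow (k i)"] by (simp add: gnext_def hd_bpow)
  qed (simp add: gnext_def)
  show ?thesis
  proof (induction m)
    case 0
    then show ?case
      using blk by simp
  next
    case (Suc m)
    have "count3 f l (gword e k (Suc (Suc m))) (GA, e (Suc (Suc m))) =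
      count3 f l (gword e k (Suc m)) (GA, e (Suc m)) +
      count3 f (glast e k m) ((GA, e (Suc m)) # bpow (k (Suc m))) (GA, e (Suc (Suc m)))"
      unfolding gword.simps(2)[of e k "Suc m"] last_gword[symmetric]
      by (subst count3_append) auto
    then show ?case
      unfolding Suc blk by simp
  qed
qed

text \<open>By periodicity block 0 follows the last block, so the term kept apart in
  \<open>count3_gword\<close> becomes the missing last summand.\<close>

lemma ccount_gword:
  assumes "coords n e k"
  shows "ccount f (gword e k n) =
    (\<Sum>i<n. count3 f (GA, e i) (bpow (k i)) (GA, e (Suc i)) +
            f (glast e k i) (GA, e (Suc i)) (gnext e k (Suc i)))"
proof -
  obtain m where n: "n = Suc m"
    using assms by (cases n) (auto simp: coords_def)
  have per: "e (Suc m) = e 0" "k (Suc m) = k 0" "e (Suc (Suc m)) = e (Suc 0)"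
    using assms unfolding coords_def n by (metis add_0 add_Suc)+
  have "ccount f (gword e k n) = count3 f (glast e k m) (gword e k (Suc m)) (GA, e (Suc m))"
    unfolding ccount_def n last_gword hd_gword per ..
  then show ?thesis
    unfolding count3_gword n by (simp add: sum.distrib gnext_def per)
qed

section \<open>Pattern counts in block coordinates\<close>

definition num_at :: "gen \<Rightarrow> letter \<Rightarrow> letter \<Rightarrow> letter \<Rightarrow> int" where
  "num_at g l x r = of_bool (fst x = g)"

definition turn_at :: "letter \<Rightarrow> letter \<Rightarrow> letter \<Rightarrow> int" where
  "turn_at l x r = of_bool (l = turn x)"

text \<open>A run of one letter between two turns, such as a b^-1 a. These are the runs that a
  Nielsen map uses up: \<open>sg\<close> for the generator b, \<open>tu\<close> for a.\<close>

definition single_at :: "gen \<Rightarrow> letter \<Rightarrow> letter \<Rightarrow> letter \<Rightarrow> int" where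
  "single_at g l x r = of_bool (fst x = g \<and> l = turn x \<and> r = turn x)"

definition double_at :: "gen \<Rightarrow> letter \<Rightarrow> letter \<Rightarrow> letter \<Rightarrow> int" where
  "double_at g l x r = of_bool (fst x = g \<and> l = x)"

text \<open>The first letter of a run of length at least two that is entered through a turn.\<close>

definition long_at :: "gen \<Rightarrow> letter \<Rightarrow> letter \<Rightarrow> letter \<Rightarrow> int" where
  "long_at g l x r = of_bool (fst x = g \<and> l = turn x \<and> r = x)"

definition sgn_of :: "bool \<Rightarrow> int" where
  "sgn_of s = (if s then -1 else 1)"

lemma count3_bpow:
  "count3 f l (bpow k) r =
     (if k = 0 then 0 else if \<bar>k\<bar> = 1 then f l (GB, k < 0) r
      else f l (GB, k < 0) (GB, k < 0) + (\<bar>k\<bar> - 2) * f (GB, k < 0) (GB, k < 0) (GB, k < 0)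
           + f (GB, k < 0) (GB, k < 0) r)"
proof (cases "k = 0")
  case False
  then obtain n where n: "nat \<bar>k\<bar> = Suc n"
    by (cases "nat \<bar>k\<bar>") auto
  then have "\<bar>k\<bar> = int n + 1"
    by linarith
  then show ?thesis
    using False unfolding bpow_def n count3_replicate by auto
qed simp

lemma num_GA_gword: "coords n e k \<Longrightarrow> ccount (num_at GA) (gword e k n) = int n"
  by (subst ccount_gword, assumption) (auto simp: count3_bpow num_at_def if_distrib cong: if_cong)

lemma num_GB_gword: "coords n e k \<Longrightarrow> ccount (num_at GB) (gword e k n) = (\<Sum>i<n. \<bar>k i\<bar>)"
  by (subst ccount_gword, assumption, rule sum.cong) (auto simp: count3_bpow num_at_def)

text \<open>A b-power forms a turn with an adjacent a-letter exactly if their signs differ; the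
  summands belong to its left and its right end.\<close>

lemma turn_gword: "coords n e k \<Longrightarrow> ccount turn_at (gword e k n) =
    (\<Sum>i<n. of_bool (sgn_of (e i) * k i < 0) + of_bool (sgn_of (e (Suc i)) * k i < 0))"
  by (subst ccount_gword, assumption, rule sum.cong)
     (auto simp: count3_bpow turn_at_def turn_def glast_def gnext_def sgn_of_def)

lemma single_GB_gword: "coords n e k \<Longrightarrow> ccount (single_at GB) (gword e k n) =
    (\<Sum>i<n. of_bool (e i = e (Suc i) \<and> k i = - sgn_of (e i)))"
  by (subst ccount_gword, assumption, rule sum.cong)
     (auto simp: count3_bpow single_at_def turn_def glast_def gnext_def sgn_of_def)

lemma single_GA_gword: "coords n e k \<Longrightarrow> ccount (single_at GA) (gword e k n) =
    (\<Sum>i<n. of_bool (sgn_of (e (Suc i)) * k i < 0 \<and> sgn_of (e (Suc i)) * k (Suc i) < 0))"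
  by (subst ccount_gword, assumption, rule sum.cong)
     (auto simp: count3_bpow single_at_def turn_def glast_def gnext_def sgn_of_def)

lemma double_GA_gword: "coords n e k \<Longrightarrow> ccount (double_at GA) (gword e k n) =
    (\<Sum>i<n. of_bool (k i = 0))"
  by (subst ccount_gword, assumption, rule sum.cong)
     (auto simp: count3_bpow double_at_def turn_def glast_def gnext_def sgn_of_def coords_def)

lemma double_GB_gword: "coords n e k \<Longrightarrow> ccount (double_at GB) (gword e k n) =
    (\<Sum>i<n. max 0 (\<bar>k i\<bar> - 1))"
  by (subst ccount_gword, assumption, rule sum.cong)
     (auto simp: count3_bpow double_at_def turn_def glast_def gnext_def sgn_of_def)

lemma long_GA_gword:
  assumes "coords n e k"
  shows "ccount (long_at GA) (gword e k n) =
    (\<Sum>i<n. of_bool (sgn_of (e (Suc i)) * k i < 0 \<and> k (Suc i) = 0))"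
  unfolding ccount_gword[OF assms]
proof (rule sum.cong)
  fix i
  have "k (Suc i) = 0 \<Longrightarrow> e (Suc i) = e (Suc (Suc i))"
    using assms by (auto simp: coords_def)
  then show "count3 (long_at GA) (GA, e i) (bpow (k i)) (GA, e (Suc i)) +
      long_at GA (glast e k i) (GA, e (Suc i)) (gnext e k (Suc i)) =
      of_bool (sgn_of (e (Suc i)) * k i < 0 \<and> k (Suc i) = 0)"
    by (cases "e (Suc i)"; cases "e (Suc (Suc i))"; cases "k i" "0 :: int" rule: linorder_cases)
       (auto simp: count3_bpow long_at_def turn_def glast_def gnext_def sgn_of_def)
qed simp

lemma long_GB_gword: "coords n e k \<Longrightarrow> ccount (long_at GB) (gword e k n) =
    (\<Sum>i<n. of_bool (sgn_of (e i) * k i \<le> - 2))"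
  by (subst ccount_gword, assumption, rule sum.cong)
     (auto simp: count3_bpow long_at_def turn_def glast_def gnext_def sgn_of_def)

lemma ccount_num: "ccount (num_at GA) w + ccount (num_at GB) w = int (length w)"
proof -
  have "count3 (num_at GA) l w r + count3 (num_at GB) l w r = int (length w)" for l r
  proof (induction "num_at GA" l w r rule: count3.induct)
    case (2 l x r)
    then show ?case by (cases "fst x") (auto simp: num_at_def)
  next
    case (3 l x y w r)
    then show ?case by (cases "fst x") (auto simp: num_at_def)
  qed simp
  then show ?thesis
    by (simp add: ccount_def)
qed

section \<open>Existence of block coordinates\<close>

lemma cyclically_reduced_rotate: "cyclically_reduced (u @ v) \<Longrightarrow> cyclically_reduced (v @ u)"
  by (cases "u = []"; cases "v = []")
     (auto simp: cyclically_reduced_def reduced_append)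

lemma parse_blocks:
  "reduced r \<Longrightarrow> \<exists>j G. r = bpow j @ concat (map (\<lambda>(s, i). (GA, s) # bpow i) G)"
proof (induction r)
  case Nil
  then show ?case
    by (intro exI[of _ 0] exI[of _ "[]"]) simp
next
  case (Cons x r)
  then obtain j G where r: "r = bpow j @ concat (map (\<lambda>(s, i). (GA, s) # bpow i) G)"
    by (auto simp: reduced_Cons)
  obtain g s where x: "x = (g, s)"
    by (cases x)
  show ?case
  proof (cases g)
    case GA
    then show ?thesis
      using r x by (intro exI[of _ 0] exI[of _ "(s, j) # G"]) simp
  next
    case GB
    have js: "j = 0 \<or> (j < 0 \<longleftrightarrow> s)"
      using Cons.prems hd_bpow[of j] unfolding r x GB
      by (cases "j = 0") (auto simp: reduced_Cons inv_l_def)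
    define j' where "j' = (if s then j - 1 else j + 1)"
    have "nat \<bar>j'\<bar> = Suc (nat \<bar>j\<bar>)" "j' < 0 \<longleftrightarrow> s"
      using js by (auto simp: j'_def)
    then have "bpow j' = (GB, s) # bpow j"
      using js by (auto simp: bpow_def)
    then show ?thesis
      using r x GB by (intro exI[of _ j'] exI[of _ G]) simp
  qed
qed

lemma gword_nth:
  "m \<le> length G \<Longrightarrow> gword (\<lambda>i. fst (G ! (i mod length G))) (\<lambda>i. snd (G ! (i mod length G))) m =
     concat (map (\<lambda>(s, i). (GA, s) # bpow i) (take m G))"
  by (induction m) (auto simp: take_Suc_conv_app_nth split_beta)

text \<open>Rotating the cyclic word to an a-letter empties the leading b-power of
  \<open>parse_blocks\<close>; reading the blocks at indices modulo their number makes e and k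
  periodic.\<close>

lemma exists_coords:
  assumes r: "cyclically_reduced r" and a: "(GA, s) \<in> set r"
  shows "\<exists>n e k u v. coords n e k \<and> r = u @ v \<and> gword e k n = v @ u"
proof -
  obtain u v where uv: "r = u @ (GA, s) # v"
    using a by (meson split_list)
  define r' where "r' = (GA, s) # v @ u"
  have r': "cyclically_reduced r'"
    using cyclically_reduced_rotate[of u "(GA, s) # v"] r by (simp add: uv r'_def)
  then obtain j G where jG: "r' = bpow j @ concat (map (\<lambda>(s, i). (GA, s) # bpow i) G)"
    using parse_blocks unfolding cyclically_reduced_def by blast
  have "j = 0"
  proof (rule ccontr)
    assume "j \<noteq> 0"
    then have "hd r' = (GB, j < 0)"
      unfolding jG by (simp add: hd_bpow)
    then show False
      by (simp add: r'_def)
  qed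
  have "G \<noteq> []"
    using jG \<open>j = 0\<close> by (auto simp: r'_def)
  then obtain m where m: "length G = Suc m"
    by (cases G) auto
  define e where "e = (\<lambda>i. fst (G ! (i mod length G)))"
  define k where "k = (\<lambda>i. snd (G ! (i mod length G)))"
  have gw: "gword e k (Suc m) = r'"
    using gword_nth[of "Suc m" G] m jG \<open>j = 0\<close> by (simp add: e_def k_def del: gword.simps)
  have per: "e (i + Suc m) = e i" "k (i + Suc m) = k i" for i
    unfolding e_def k_def m[symmetric] by simp_all
  have cond: "k i = 0 \<longrightarrow> e i = e (Suc i)" if "i < Suc m" for i
    using r' that per(1)[of 0] unfolding gw[symmetric]
    by (subst (asm) cyclically_reduced_gword) auto
  have "k i = 0 \<longrightarrow> e i = e (Suc i)" for i
    using cond[of "i mod Suc m"] unfolding e_def k_def m by (simp add: mod_Suc_eq)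
  then have "coords (Suc m) e k"
    using per unfolding coords_def by auto
  then show ?thesis
    using gw uv unfolding r'_def
    by (intro exI[of _ "Suc m"] exI[of _ e] exI[of _ k] exI[of _ u] exI[of _ "(GA, s) # v"]) auto
qed

section \<open>The action of a -> ab on block exponents\<close>

definition gshift :: "(nat \<Rightarrow> bool) \<Rightarrow> (nat \<Rightarrow> int) \<Rightarrow> nat \<Rightarrow> int" where
  "gshift e k i = k i + of_bool (\<not> e i) - of_bool (e (Suc i))"

text \<open>Where neighbouring a-letters have different signs the shift is zero, so the nonzero
  exponent between them survives. Hence a-letters never cancel under \<open>sg\<close>.\<close>

lemma coords_gshift: "coords n e k \<Longrightarrow> coords n e (gshift e k)"
  unfolding coords_def gshift_def
  by (auto simp: add_Suc[symmetric] simp del: add_Suc split: if_splits)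

lemma sg_GA: "bpow (of_bool s) @ sg [(GA, s)] \<approx> (GA, s) # bpow (of_bool (\<not> s))"
proof (cases s)
  case True
  have "bpow 1 @ sg [(GA, True)] = (GB, False) # inv_l (GB, False) # [(GA, True)]"
    by (simp add: ext_def bpow_def inv_l_def)
  then show ?thesis
    using True freq_cancel[of "(GB, False)" "[(GA, True)]"] by simp
qed (simp add: ext_def bpow_def)

text \<open>A letter a adds a b to its own block, but a^-1 becomes b^-1 a^-1 and affects the block
  before it. The trailing factor \<open>bpow (- of_bool (e m))\<close> lends this b^-1 to the
  current block in advance; after a full period it equals the leading factor and disappears by
  conjugation.\<close>

lemma sg_gword_aux:
  "sg (gword e k m) @ bpow (- of_bool (e m)) \<approx> bpow (- of_bool (e 0)) @ gword e (gshift e k) m"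
proof (induction m)
  case (Suc m)
  let ?c = "\<lambda>i. bpow (- of_bool (e i))" and ?d = "\<lambda>i. bpow (of_bool (e i))"
  have d: "?d m = finv (?c m)"
    by (simp add: finv_bpow)
  have "sg (gword e k (Suc m)) @ ?c (Suc m) =
      sg (gword e k m) @ (sg [(GA, e m)] @ bpow (k m) @ ?c (Suc m))"
    by (simp add: ext_append ext_Cons sg_bpow)
  also have "\<dots> \<approx> sg (gword e k m) @ ?c m @ ?d m @ (sg [(GA, e m)] @ bpow (k m) @ ?c (Suc m))"
    unfolding d by (rule freq_sym[OF freq_mid_finv_right])
  also have "\<dots> = (sg (gword e k m) @ ?c m) @ (?d m @ sg [(GA, e m)]) @ (bpow (k m) @ ?c (Suc m))"
    by simp
  also have "\<dots> \<approx> (?c 0 @ gword e (gshift e k) m) @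
      ((GA, e m) # bpow (of_bool (\<not> e m))) @ bpow (k m - of_bool (e (Suc m)))"
    using bpow_add[of "k m" "- of_bool (e (Suc m))"] by (intro freq_append Suc sg_GA) simp
  also have "\<dots> = (?c 0 @ gword e (gshift e k) m @ [(GA, e m)]) @
      (bpow (of_bool (\<not> e m)) @ bpow (k m - of_bool (e (Suc m))))"
    by simp
  also have "\<dots> \<approx> (?c 0 @ gword e (gshift e k) m @ [(GA, e m)]) @
      bpow (of_bool (\<not> e m) + (k m - of_bool (e (Suc m))))"
    by (intro freq_append bpow_add freq_refl)
  also have "\<dots> = ?c 0 @ gword e (gshift e k) (Suc m)"
    by (simp add: gshift_def algebra_simps)
  finally show ?case .
qed simp

lemma sg_gword:
  assumes "coords n e k"
  shows "sg (gword e k n) \<sim> gword e (gshift e k) n"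
proof -
  have "e n = e 0"
    using assms unfolding coords_def by (metis add_0)
  then have "sg (gword e k n) \<approx> (bpow (- of_bool (e 0)) @ gword e (gshift e k) n) @ finv (bpow (- of_bool (e 0)))"
    using freq_move_right[OF sg_gword_aux[of e k n]] by simp
  then show ?thesis
    by (intro fconjI) simp
qed

text \<open>Between a-letters of equal sign the exponent moves one step towards that sign; otherwise
  it stays. Turns are therefore lost only where an exponent of opposite sign reaches zero, and there
  both ends of the b-power lose one.\<close>

lemma turn_gshift:
  assumes "coords n e k"
  shows "ccount turn_at (gword e (gshift e k) n) =
         ccount turn_at (gword e k n) - 2 * ccount (single_at GB) (gword e k n)"
proof -
  have "k i = 0 \<Longrightarrow> e i = e (Suc i)" for i
    using assms by (auto simp: coords_def)
  then show ?thesis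
    unfolding turn_gword[OF assms] turn_gword[OF coords_gshift[OF assms]] single_GB_gword[OF assms]
      sum_distrib_left sum_subtractf[symmetric]
    by (intro sum.cong) (auto simp: gshift_def sgn_of_def)
qed

text \<open>The absolute value of an exponent grows by 1, 0 or -1 according as the b-power has 0, 1
  or 2 turns at its ends.\<close>

lemma num_GB_gshift:
  assumes "coords n e k"
  shows "ccount (num_at GB) (gword e (gshift e k) n) =
         ccount (num_at GB) (gword e k n) + ccount (num_at GA) (gword e k n) - ccount turn_at (gword e k n)"
proof -
  have 0: "k i = 0 \<Longrightarrow> e i = e (Suc i)" for i
    using assms by (auto simp: coords_def)
  have n: "int n = (\<Sum>i<n. 1)"
    by simp
  show ?thesis
    unfolding turn_gword[OF assms] num_GB_gword[OF assms] num_GA_gword[OF assms]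
      num_GB_gword[OF coords_gshift[OF assms]] n sum.distrib[symmetric] sum_subtractf[symmetric]
  proof (rule sum.cong)
    fix i
    show "\<bar>gshift e k i\<bar> = \<bar>k i\<bar> + 1 -
        (of_bool (sgn_of (e i) * k i < 0) + of_bool (sgn_of (e (Suc i)) * k i < 0))"
      using 0[of i] by (cases "e i"; cases "e (Suc i)"; cases "k i" "0 :: int" rule: linorder_cases)
        (auto simp: gshift_def sgn_of_def)
  qed simp
qed

text \<open>Relative to the sign of an adjacent a-letter no exponent decreases, so opposite signs
  afterwards were opposite before.\<close>

lemma single_GA_gshift_le:
  assumes "coords n e k"
  shows "ccount (single_at GA) (gword e (gshift e k) n) \<le> ccount (single_at GA) (gword e k n)"
  unfolding single_GA_gword[OF assms] single_GA_gword[OF coords_gshift[OF assms]]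
  by (intro sum_mono) (auto simp: gshift_def sgn_of_def)

text \<open>Opposite signs are lost only at an exponent that reaches zero, that is, at a used-up
  b-letter, and these are excluded.\<close>

lemma single_GA_gshift_eq:
  assumes "coords n e k" and 0: "ccount (single_at GB) (gword e k n) = 0"
  shows "ccount (single_at GA) (gword e (gshift e k) n) = ccount (single_at GA) (gword e k n)"
proof -
  have nz: "\<not> (e i = e (Suc i) \<and> k i = - sgn_of (e i))" if "i < n" for i
    using 0 that unfolding single_GB_gword[OF assms(1)]
    by (subst (asm) sum_nonneg_eq_0_iff) auto
  have per: "e (n + i) = e i" "k (n + i) = k i" for i
    using assms(1) unfolding coords_def by (metis add.commute)+
  \<comment> \<open>The index \<open>Suc i\<close> below may be n, which is block 0 again.\<close>
  have nz': "\<not> (e i = e (Suc i) \<and> k i = - sgn_of (e i))" if "i \<le> n" for i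
    using nz[of i] nz[of 0] per[of 0] per[of "Suc 0"] that assms(1)
    by (cases "i = n") (auto simp: coords_def)
  show ?thesis
    unfolding single_GA_gword[OF assms(1)] single_GA_gword[OF coords_gshift[OF assms(1)]]
  proof (rule sum.cong)
    fix i assume "i \<in> {..<n}"
    then show "(of_bool (sgn_of (e (Suc i)) * gshift e k i < 0 \<and>
        sgn_of (e (Suc i)) * gshift e k (Suc i) < 0) :: int) =
        of_bool (sgn_of (e (Suc i)) * k i < 0 \<and> sgn_of (e (Suc i)) * k (Suc i) < 0)"
      using nz'[of i] nz'[of "Suc i"]
      by (cases "e i"; cases "e (Suc i)"; cases "e (Suc (Suc i))") (auto simp: gshift_def sgn_of_def)
  qed simp
qed

text \<open>An exponent that is already zero moves away from zero, so equal adjacent a-letters in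
  the image come only from used-up b-letters.\<close>

lemma double_GA_gshift:
  assumes "coords n e k"
  shows "ccount (double_at GA) (gword e (gshift e k) n) = ccount (single_at GB) (gword e k n)"
proof -
  have 0: "k i = 0 \<Longrightarrow> e i = e (Suc i)" for i
    using assms by (auto simp: coords_def)
  show ?thesis
    unfolding single_GB_gword[OF assms] double_GA_gword[OF coords_gshift[OF assms]]
  proof (rule sum.cong)
    fix i
    show "(of_bool (gshift e k i = 0) :: int) = of_bool (e i = e (Suc i) \<and> k i = - sgn_of (e i))"
      using 0[of i] by (cases "e i"; cases "e (Suc i)") (auto simp: gshift_def sgn_of_def)
  qed simp
qed

text \<open>The initial letter of a long a-run in the image is followed by a used-up b-letter.
  Before the map, that b-letter and the b-power in front both had the sign opposite to it, so it
  stood alone between two turns.\<close>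

lemma long_GA_gshift:
  assumes "coords n e k"
  shows "ccount (long_at GA) (gword e (gshift e k) n) \<le> ccount (single_at GA) (gword e k n)"
proof -
  have 0: "k i = 0 \<Longrightarrow> e i = e (Suc i)" for i
    using assms by (auto simp: coords_def)
  show ?thesis
    unfolding single_GA_gword[OF assms] long_GA_gword[OF coords_gshift[OF assms]]
  proof (rule sum_mono)
    fix i
    show "(of_bool (sgn_of (e (Suc i)) * gshift e k i < 0 \<and> gshift e k (Suc i) = 0) :: int) \<le>
        of_bool (sgn_of (e (Suc i)) * k i < 0 \<and> sgn_of (e (Suc i)) * k (Suc i) < 0)"
      using 0[of "Suc i"]
      by (cases "e i"; cases "e (Suc i)"; cases "e (Suc (Suc i))") (auto simp: gshift_def sgn_of_def)
  qed
qed

section \<open>Turns\<close>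

definition is_rep :: "letter list \<Rightarrow> letter list \<Rightarrow> bool" where
  "is_rep w r \<longleftrightarrow> cyclically_reduced r \<and> w \<sim> r"

lemma exists_rep: "\<exists>r. is_rep w r"
  using exists_cyclically_reduced by (auto simp: is_rep_def)

lemma is_rep_length: "is_rep w r \<Longrightarrow> length r = clen w"
  by (metis is_rep_def clen_eq)

lemma is_rep_coords:
  assumes "is_rep w r" "(GA, s) \<in> set r"
  obtains n e k where "coords n e k" "is_rep w (gword e k n)"
    "\<And>f. ccount f (gword e k n) = ccount f r"
proof -
  obtain n e k u v where *: "coords n e k" "r = u @ v" "gword e k n = v @ u"
    using exists_coords assms unfolding is_rep_def by blast
  have "w \<sim> v @ u"
    using assms(1) fconj_rotate[of u v] fconj_trans unfolding is_rep_def *(2) by blast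
  then show ?thesis
    using that[of n e k] * ccount_rotate[of _ u v] coords_cyclically_reduced[OF *(1)]
    by (simp add: is_rep_def)
qed

lemma is_rep_gshift:
  assumes "coords n e k" "is_rep w (gword e k n)"
  shows "is_rep (sg w) (gword e (gshift e k) n)"
  using coords_cyclically_reduced[OF coords_gshift[OF assms(1)]] sg_gword[OF assms(1)]
    ext_fconj assms(2) fconj_trans unfolding is_rep_def by blast

lemma count3_eq_0:
  assumes "\<And>a b c. {a, b, c} \<subseteq> S \<Longrightarrow> f a b c = 0"
  shows "insert l (insert r (set w)) \<subseteq> S \<Longrightarrow> count3 f l w r = 0"
  using assms by (induction f l w r rule: count3.induct) auto

lemma ccount_eq_0:
  assumes "\<And>a b c. {a, b, c} \<subseteq> set w \<Longrightarrow> f a b c = 0"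
  shows "ccount f w = 0"
proof (cases "w = []")
  case False
  then show ?thesis
    unfolding ccount_def by (intro count3_eq_0[of "set w"] assms) auto
qed (simp add: ccount_def)

text \<open>Words without a-letters have no block coordinates; this is their separate
  treatment.\<close>

lemma no_GA:
  assumes "\<And>s. (GA, s) \<notin> set r"
  shows "sg r = r" "ccount turn_at r = 0" "ccount (num_at GA) r = 0"
    "ccount (single_at g) r = 0" "ccount (double_at GA) r = 0" "ccount (long_at g) r = 0"
proof -
  have GB: "fst x = GB" if "x \<in> set r" for x
    using assms that by (cases x; cases "fst x") auto
  show "sg r = r"
    using GB
  proof (induction r)
    case (Cons x r)
    have "fst x = GB"
      using Cons.prems[of x] by simp
    then have "letter_image [(GA, False), (GB, False)] [(GB, False)] x = [x]"
      by (cases x) (auto simp: inv_l_def)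
    then show ?case
      using Cons by (simp add: ext_Cons)
  qed simp
  show "ccount turn_at r = 0" "ccount (num_at GA) r = 0"
    "ccount (single_at g) r = 0" "ccount (double_at GA) r = 0" "ccount (long_at g) r = 0"
    by (rule ccount_eq_0; auto simp: turn_at_def num_at_def single_at_def double_at_def
        long_at_def turn_def dest!: GB)+
qed

text \<open>Gathers the block computations for one \<open>sg\<close> in terms of representatives,
  including the words that have no blocks.\<close>

lemma sg_step:
  assumes "is_rep w r"
  obtains r' where "is_rep (sg w) r'"
    "ccount turn_at r' = ccount turn_at r - 2 * ccount (single_at GB) r"
    "ccount (num_at GA) r' = ccount (num_at GA) r"
    "ccount (num_at GB) r' = ccount (num_at GB) r + ccount (num_at GA) r - ccount turn_at r"
    "ccount (single_at GA) r' \<le> ccount (single_at GA) r"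
    "ccount (single_at GB) r = 0 \<Longrightarrow> ccount (single_at GA) r' = ccount (single_at GA) r"
    "ccount (double_at GA) r' = ccount (single_at GB) r"
    "ccount (long_at GA) r' \<le> ccount (single_at GA) r"
proof (cases "\<exists>s. (GA, s) \<in> set r")
  case True
  then obtain n e k where *: "coords n e k" "is_rep w (gword e k n)"
    "\<And>f. ccount f (gword e k n) = ccount f r"
    using is_rep_coords[OF assms] by metis
  show ?thesis
    using that[OF is_rep_gshift[OF *(1,2)]] turn_gshift[OF *(1)] num_GB_gshift[OF *(1)]
      num_GA_gword[OF *(1)] num_GA_gword[OF coords_gshift[OF *(1)]]
      single_GA_gshift_le[OF *(1)] single_GA_gshift_eq[OF *(1)] double_GA_gshift[OF *(1)]
      long_GA_gshift[OF *(1)]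
    unfolding *(3) by simp
next
  case False
  then have 0: "\<And>s. (GA, s) \<notin> set r"
    by blast
  have "is_rep (sg w) r"
    using assms ext_fconj[of w r] no_GA(1)[OF 0] unfolding is_rep_def by metis
  then show ?thesis
    using that no_GA(2-6)[OF 0] by simp
qed

section \<open>Symmetry between the two generators\<close>

definition swap_letter :: "letter \<Rightarrow> letter" where
  "swap_letter x = (other (fst x), snd x)"

lemma sw_eq_map: "sw w = map swap_letter w"
proof (induction w)
  case (Cons x w)
  then show ?case
    by (cases x; cases "fst x") (auto simp: ext_Cons swap_letter_def inv_l_def)
qed simp

lemma swap_letter_inv_l: "swap_letter (inv_l x) = inv_l (swap_letter x)"
  by (simp add: swap_letter_def inv_l_def)

lemma swap_letter_swap_letter [simp]: "swap_letter (swap_letter x) = x"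
  by (simp add: swap_letter_def)

lemma swap_letter_eq_iff [simp]: "swap_letter x = swap_letter y \<longleftrightarrow> x = y"
  by (metis swap_letter_swap_letter)

lemma cyclically_reduced_map:
  assumes "\<And>x. h (inv_l x) = inv_l (h x)" "inj h"
  shows "cyclically_reduced (map h w) \<longleftrightarrow> cyclically_reduced w"
proof -
  have eq: "h x = inv_l (h y) \<longleftrightarrow> x = inv_l y" for x y
    using assms by (metis injD)
  have "reduced (map h w) \<longleftrightarrow> reduced w"
    unfolding reduced_def successively_map eq ..
  then show ?thesis
    by (cases "w = []") (auto simp: cyclically_reduced_def last_map hd_map eq)
qed

lemma count3_map: "count3 f (h l) (map h w) (h r) = count3 (\<lambda>a b c. f (h a) (h b) (h c)) l w r"
  by (induction f l w r rule: count3.induct) auto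

lemma ccount_map: "ccount f (map h w) = ccount (\<lambda>a b c. f (h a) (h b) (h c)) w"
  by (cases "w = []") (auto simp: ccount_def last_map hd_map count3_map)

lemma other_eq_iff: "other x = y \<longleftrightarrow> x = other y"
  by (metis other_other(1))

lemma ccount_sw:
  "ccount turn_at (sw w) = ccount turn_at w"
  "ccount (num_at g) (sw w) = ccount (num_at (other g)) w"
  "ccount (single_at g) (sw w) = ccount (single_at (other g)) w"
  "ccount (double_at g) (sw w) = ccount (double_at (other g)) w"
  "ccount (long_at g) (sw w) = ccount (long_at (other g)) w"
proof -
  have t: "turn (swap_letter x) = swap_letter (turn x)" for x
    by (simp add: turn_def swap_letter_def)
  have f: "fst (swap_letter x) = y \<longleftrightarrow> fst x = other y" for x y
    by (simp add: swap_letter_def other_eq_iff)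
  show "ccount turn_at (sw w) = ccount turn_at w"
    "ccount (num_at g) (sw w) = ccount (num_at (other g)) w"
    "ccount (single_at g) (sw w) = ccount (single_at (other g)) w"
    "ccount (double_at g) (sw w) = ccount (double_at (other g)) w"
    "ccount (long_at g) (sw w) = ccount (long_at (other g)) w"
    unfolding sw_eq_map ccount_map turn_at_def num_at_def single_at_def double_at_def long_at_def
      t f swap_letter_eq_iff by rule+
qed

lemma sw_sw [simp]: "sw (sw w) = w"
  by (induction w) (auto simp: sw_eq_map)

lemma is_rep_sw: "is_rep w r \<Longrightarrow> is_rep (sw w) (sw r)"
  unfolding is_rep_def
proof (intro conjI)
  assume r: "cyclically_reduced r \<and> w \<sim> r"
  show "cyclically_reduced (sw r)"
    unfolding sw_eq_map using r cyclically_reduced_map[of swap_letter r]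
    by (auto simp: swap_letter_inv_l inj_def)
  show "sw w \<sim> sw r"
    using r by (blast intro: ext_fconj)
qed

text \<open>Exchanging the generators turns a -> ab into b -> ba, so results on \<open>sg\<close>
  carry over to \<open>tu\<close> with a and b exchanged.\<close>

lemma sg_sw: "sg (sw w) = sw (tu w)"
  by (simp add: ext_ext ext_Cons)

lemma tu_sw: "tu (sw w) = sw (sg w)"
  by (simp add: ext_ext ext_Cons)

lemma clen_sw: "clen (sw w) = clen w"
proof -
  obtain r where r: "is_rep w r"
    using exists_rep by blast
  then show ?thesis
    using is_rep_length[OF r] is_rep_length[OF is_rep_sw[OF r]] by (simp add: sw_eq_map)
qed

section \<open>Turn and letter numbers as functions of cyclic lengths\<close>

lemma clen_sg:
  assumes "is_rep w r"
  shows "int (clen (sg w)) = int (clen w) + ccount (num_at GA) r - ccount turn_at r"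
proof -
  obtain r' where "is_rep (sg w) r'" "ccount (num_at GA) r' = ccount (num_at GA) r"
    "ccount (num_at GB) r' = ccount (num_at GB) r + ccount (num_at GA) r - ccount turn_at r"
    using sg_step[OF assms] by metis
  then show ?thesis
    using is_rep_length[OF assms] is_rep_length ccount_num[of r] ccount_num[of r'] by fastforce
qed

lemma clen_tu:
  assumes "is_rep w r"
  shows "int (clen (tu w)) = int (clen w) + ccount (num_at GB) r - ccount turn_at r"
  using clen_sg[OF is_rep_sw[OF assms]] by (simp add: sg_sw clen_sw ccount_sw)

text \<open>Solves the sum of \<open>clen_sg\<close> and \<open>clen_tu\<close> for the number of
  turns. Defined from cyclic lengths, it is a class invariant on which words with equal lengths
  visibly agree.\<close>

definition turns :: "letter list \<Rightarrow> int" where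
  "turns w = (3 * int (clen w) - int (clen (sg w)) - int (clen (tu w))) div 2"

lemma turns_eq: "is_rep w r \<Longrightarrow> turns w = ccount turn_at r"
  using clen_sg[of w r] clen_tu[of w r] is_rep_length[of w r] ccount_num[of r]
  by (simp add: turns_def)

lemma turns_sw: "turns (sw w) = turns w"
  by (simp add: turns_def sg_sw tu_sw clen_sw)

definition num_a :: "letter list \<Rightarrow> int" where
  "num_a w = int (clen (sg w)) - int (clen w) + turns w"

definition num_b :: "letter list \<Rightarrow> int" where
  "num_b w = int (clen (tu w)) - int (clen w) + turns w"

lemma num_a_eq: "is_rep w r \<Longrightarrow> num_a w = ccount (num_at GA) r"
  by (simp add: num_a_def clen_sg turns_eq)

lemma num_b_eq: "is_rep w r \<Longrightarrow> num_b w = ccount (num_at GB) r"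
  by (simp add: num_b_def clen_tu turns_eq)

lemma clen_eq_num: "int (clen w) = num_a w + num_b w"
  using exists_rep[of w] num_a_eq num_b_eq is_rep_length ccount_num by fastforce

lemma num_a_sw: "num_a (sw w) = num_b w"
  by (simp add: num_a_def num_b_def turns_sw clen_sw sg_sw)

text \<open>Only the number of turns enters besides the letter numbers, so equal turn numbers along
  a product keep equal letter numbers equal.\<close>

lemma num_sg: "num_a (sg w) = num_a w" "num_b (sg w) = num_a w + num_b w - turns w"
proof -
  obtain r where r: "is_rep w r"
    using exists_rep by blast
  obtain r' where "is_rep (sg w) r'" "ccount (num_at GA) r' = ccount (num_at GA) r"
    "ccount (num_at GB) r' = ccount (num_at GB) r + ccount (num_at GA) r - ccount turn_at r"
    using sg_step[OF r] by metis
  then show "num_a (sg w) = num_a w" "num_b (sg w) = num_a w + num_b w - turns w"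
    using r by (simp_all add: num_a_eq num_b_eq turns_eq)
qed

lemma num_tu: "num_b (tu w) = num_b w" "num_a (tu w) = num_a w + num_b w - turns w"
  using num_sg[of "sw w"] num_a_sw[of "sw (tu w)"] num_a_sw[of "sw w"]
  by (simp_all add: sg_sw num_a_sw turns_sw)

lemma ccount_nonneg: "(\<And>a b c. f a b c \<ge> 0) \<Longrightarrow> ccount f w \<ge> 0"
proof -
  assume "\<And>a b c. f a b c \<ge> 0"
  then have "count3 f l w r \<ge> 0" for l r
    by (induction f l w r rule: count3.induct) auto
  then show ?thesis
    by (simp add: ccount_def)
qed

lemma ccount_le_length: "(\<And>a b c. f a b c \<le> 1) \<Longrightarrow> ccount f w \<le> int (length w)"
proof -
  assume "\<And>a b c. f a b c \<le> 1"
  then have "count3 f l w r \<le> int (length w)" for l r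
  proof (induction f l w r rule: count3.induct)
    case (3 f l x y w r)
    then show ?case
      using add_mono[OF 3(2)[of l x y] 3(1)[OF 3(2)]] by simp
  qed auto
  then show ?thesis
    by (simp add: ccount_def)
qed

lemma turns_nonneg: "turns w \<ge> 0"
  using exists_rep[of w] turns_eq ccount_nonneg[of turn_at] by (auto simp: turn_at_def)

lemma turns_le: "turns w \<le> int (clen w)"
proof -
  obtain r where r: "is_rep w r"
    using exists_rep by blast
  then show ?thesis
    using ccount_le_length[of turn_at r] is_rep_length[OF r] by (simp add: turns_eq turn_at_def)
qed

section \<open>Turns lost under a Nielsen map\<close>

definition sdrop :: "letter list \<Rightarrow> int" where
  "sdrop w = turns w - turns (sg w)"

definition tdrop :: "letter list \<Rightarrow> int" where
  "tdrop w = turns w - turns (tu w)"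

lemma sdrop_sw: "sdrop (sw w) = tdrop w"
  by (simp add: sdrop_def tdrop_def sg_sw turns_sw)

lemma sdrop_eq: "is_rep w r \<Longrightarrow> sdrop w = 2 * ccount (single_at GB) r"
  by (rule sg_step) (auto simp: sdrop_def turns_eq)

lemma tdrop_eq: "is_rep w r \<Longrightarrow> tdrop w = 2 * ccount (single_at GA) r"
  using sdrop_eq[OF is_rep_sw] by (simp add: sdrop_sw ccount_sw)

lemma sdrop_nonneg: "sdrop w \<ge> 0"
  using exists_rep[of w] sdrop_eq ccount_nonneg[of "single_at GB"] by (auto simp: single_at_def)

lemma tdrop_nonneg: "tdrop w \<ge> 0"
  using sdrop_nonneg[of "sw w"] by (simp add: sdrop_sw)

lemma gshift_funpow: "(gshift e ^^ m) k i = k i + int m * (of_bool (\<not> e i) - of_bool (e (Suc i)))"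
  by (induction m arbitrary: k) (auto simp: gshift_def algebra_simps)

text \<open>A b-run used up after m applications of \<open>sg\<close> has been shortened by one each
  time, so it is a run of m + 1 letters in w between two turns. Such a run contains m equal adjacent
  pairs and is long if m > 0.\<close>

lemma sdrop_funpow:
  assumes r: "is_rep w r" and drop: "sdrop ((sg ^^ m) w) \<noteq> 0"
  shows "int m \<le> ccount (double_at GB) r" "int m < ccount (num_at GB) r"
    "m > 0 \<Longrightarrow> ccount (long_at GB) r > 0"
proof -
  have "\<exists>s. (GA, s) \<in> set r"
  proof (rule ccontr)
    assume "\<nexists>s. (GA, s) \<in> set r"
    then have 0: "\<And>s. (GA, s) \<notin> set r"
      by blast
    have "is_rep ((sg ^^ m) w) r"
    proof (induction m)
      case (Suc m)
      then show ?case
        using ext_fconj[of _ r] no_GA(1)[OF 0] unfolding is_rep_def funpow.simps o_apply by metis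
    qed (use r in simp)
    then show False
      using drop no_GA(4)[OF 0] by (simp add: sdrop_eq)
  qed
  then obtain n e k where c: "coords n e k" and rep: "is_rep w (gword e k n)"
    and eq: "\<And>f. ccount f (gword e k n) = ccount f r"
    using is_rep_coords[OF r] by metis
  have cm: "coords n e ((gshift e ^^ m) k)" "is_rep ((sg ^^ m) w) (gword e ((gshift e ^^ m) k) n)"
    by (induction m) (auto simp: c rep coords_gshift is_rep_gshift)
  then have "(\<Sum>i<n. of_bool (e i = e (Suc i) \<and> (gshift e ^^ m) k i = - sgn_of (e i)) :: int) \<noteq> 0"
    using drop sdrop_eq[OF cm(2)] single_GB_gword[OF cm(1)] by linarith
  then obtain i where "i \<in> {..<n}"
    "of_bool (e i = e (Suc i) \<and> (gshift e ^^ m) k i = - sgn_of (e i)) \<noteq> (0 :: int)"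
    by (rule sum.not_neutral_contains_not_neutral)
  then have i: "i < n" "e i = e (Suc i)" "(gshift e ^^ m) k i = - sgn_of (e i)"
    by auto
  have k: "sgn_of (e i) * k i = - int m - 1"
    using i(2,3) by (cases "e i") (auto simp: gshift_funpow sgn_of_def)
  then have k': "\<bar>k i\<bar> = int m + 1"
    by (cases "e i") (auto simp: sgn_of_def)
  have "max 0 (\<bar>k i\<bar> - 1) \<le> ccount (double_at GB) r"
    unfolding eq[symmetric] double_GB_gword[OF c]
    by (rule member_le_sum[of i "{..<n}" "\<lambda>i. max 0 (\<bar>k i\<bar> - 1)"]) (use i in auto)
  then show "int m \<le> ccount (double_at GB) r"
    using k' by simp
  have "\<bar>k i\<bar> \<le> ccount (num_at GB) r"
    unfolding eq[symmetric] num_GB_gword[OF c]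
    by (rule member_le_sum[of i "{..<n}" "\<lambda>i. \<bar>k i\<bar>"]) (use i in auto)
  then show "int m < ccount (num_at GB) r"
    using k' by simp
  assume "m > 0"
  have "of_bool (sgn_of (e i) * k i \<le> - 2) \<le> ccount (long_at GB) r"
    unfolding eq[symmetric] long_GB_gword[OF c]
    by (rule member_le_sum[of i "{..<n}" "\<lambda>i. of_bool (sgn_of (e i) * k i \<le> - 2)"]) (use i in auto)
  then show "ccount (long_at GB) r > 0"
    using k \<open>m > 0\<close> by simp
qed

lemma funpow_sg_sw: "(sg ^^ m) (sw w) = sw ((tu ^^ m) w)"
  by (induction m) (auto simp: sg_sw)

lemma funpow_tu_sw: "(tu ^^ m) (sw w) = sw ((sg ^^ m) w)"
  by (induction m) (auto simp: tu_sw)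

lemma tdrop_funpow:
  assumes r: "is_rep w r" and drop: "tdrop ((tu ^^ m) w) \<noteq> 0"
  shows "int m \<le> ccount (double_at GA) r" "int m < ccount (num_at GA) r"
    "m > 0 \<Longrightarrow> ccount (long_at GA) r > 0"
  using sdrop_funpow[OF is_rep_sw[OF r], of m] drop
  by (simp_all add: funpow_sg_sw sdrop_sw ccount_sw)

lemma sdrop_funpow_eq_0: "m \<ge> clen w \<Longrightarrow> sdrop ((sg ^^ m) w) = 0"
proof -
  obtain r where r: "is_rep w r"
    using exists_rep by blast
  assume "m \<ge> clen w"
  moreover have "ccount (num_at GB) r \<le> int (length r)"
    by (rule ccount_le_length) (simp add: num_at_def)
  ultimately show ?thesis
    using sdrop_funpow(2)[OF r, of m] is_rep_length[OF r] by fastforce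
qed

lemma tdrop_funpow_eq_0: "m \<ge> clen w \<Longrightarrow> tdrop ((tu ^^ m) w) = 0"
  using sdrop_funpow_eq_0[of "sw w" m] by (simp add: clen_sw funpow_sg_sw sdrop_sw)

lemma tdrop_sg_le: "tdrop (sg w) \<le> tdrop w"
proof -
  obtain r where r: "is_rep w r"
    using exists_rep by blast
  show ?thesis
    by (rule sg_step[OF r]) (simp add: tdrop_eq tdrop_eq[OF r])
qed

lemma tdrop_sg_eq: "sdrop w = 0 \<Longrightarrow> tdrop (sg w) = tdrop w"
proof -
  assume 0: "sdrop w = 0"
  obtain r where r: "is_rep w r"
    using exists_rep by blast
  show ?thesis
    by (rule sg_step[OF r]) (use 0 in \<open>simp add: tdrop_eq tdrop_eq[OF r] sdrop_eq[OF r]\<close>)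
qed

text \<open>The loss requires at least m equal adjacent pairs of a-letters in \<open>sg w\<close>.
  Each comes from a used-up b-letter, which costs two turns.\<close>

lemma tdrop_funpow_sg_le: "tdrop ((tu ^^ m) (sg w)) \<noteq> 0 \<Longrightarrow> 2 * int m \<le> sdrop w"
proof -
  assume 0: "tdrop ((tu ^^ m) (sg w)) \<noteq> 0"
  obtain r where r: "is_rep w r"
    using exists_rep by blast
  obtain r' where "is_rep (sg w) r'" "ccount (double_at GA) r' = ccount (single_at GB) r"
    using sg_step[OF r] by metis
  then show ?thesis
    using tdrop_funpow(1)[OF _ 0] sdrop_eq[OF r] by fastforce
qed

text \<open>If w has no single a between two turns, \<open>sg\<close> creates none, and by
  \<open>long_GA_gshift\<close> it creates no longer a-run between turns either.\<close>

lemma tdrop_funpow_sg_eq_0: "tdrop w = 0 \<Longrightarrow> tdrop ((tu ^^ m) (sg w)) = 0"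
proof (cases "m = 0")
  case True
  then show "tdrop w = 0 \<Longrightarrow> tdrop ((tu ^^ m) (sg w)) = 0"
    using tdrop_sg_le[of w] tdrop_nonneg[of "sg w"] by simp
next
  case False
  assume 0: "tdrop w = 0"
  obtain r where r: "is_rep w r"
    using exists_rep by blast
  obtain r' where "is_rep (sg w) r'" "ccount (long_at GA) r' \<le> ccount (single_at GA) r"
    using sg_step[OF r] by metis
  then show ?thesis
    using tdrop_funpow(3)[of "sg w" r' m] tdrop_eq[OF r] False 0 by fastforce
qed

lemma sdrop_funpow_tu_eq_0: "sdrop w = 0 \<Longrightarrow> sdrop ((sg ^^ m) (tu w)) = 0"
  using tdrop_funpow_sg_eq_0[of "sw w" m] sdrop_sw[of "sw ((sg ^^ m) (tu w))"] sdrop_sw[of "sw w"]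
  by (simp add: sg_sw funpow_tu_sw)

section \<open>A bound on the number of Nielsen maps to be tested\<close>

text \<open>The length of the longest a-run between two turns, zero if there is none: a run of
  length m + 1 causes a loss exactly at the application of \<open>tu\<close> after m earlier
  ones.\<close>

definition tu_rank :: "letter list \<Rightarrow> nat" where
  "tu_rank w = (LEAST p. \<forall>m\<ge>p. tdrop ((tu ^^ m) w) = 0)"

definition sg_rank :: "letter list \<Rightarrow> nat" where
  "sg_rank w = (LEAST p. \<forall>m\<ge>p. sdrop ((sg ^^ m) w) = 0)"

lemma tu_rank_sw: "tu_rank (sw w) = sg_rank w"
proof -
  have "tdrop (sw x) = sdrop x" for x
    using sdrop_sw[of "sw x"] by simp
  then show ?thesis
    by (simp add: tu_rank_def sg_rank_def funpow_tu_sw)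
qed

lemma sg_rank_sw: "sg_rank (sw w) = tu_rank w"
  using tu_rank_sw[of "sw w"] by simp

lemma sg_rank_le: "(\<And>m. m \<ge> p \<Longrightarrow> sdrop ((sg ^^ m) w) = 0) \<Longrightarrow> sg_rank w \<le> p"
  unfolding sg_rank_def by (rule Least_le) blast

lemma tu_rank_le: "(\<And>m. m \<ge> p \<Longrightarrow> tdrop ((tu ^^ m) w) = 0) \<Longrightarrow> tu_rank w \<le> p"
  unfolding tu_rank_def by (rule Least_le) blast

lemma sg_rank: "m \<ge> sg_rank w \<Longrightarrow> sdrop ((sg ^^ m) w) = 0"
proof -
  have "\<forall>m\<ge>clen w. sdrop ((sg ^^ m) w) = 0"
    using sdrop_funpow_eq_0 by blast
  then have "\<forall>m\<ge>sg_rank w. sdrop ((sg ^^ m) w) = 0"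
    unfolding sg_rank_def by (rule LeastI)
  then show "m \<ge> sg_rank w \<Longrightarrow> sdrop ((sg ^^ m) w) = 0"
    by blast
qed

lemma tu_rank: "m \<ge> tu_rank w \<Longrightarrow> tdrop ((tu ^^ m) w) = 0"
proof -
  have "\<forall>m\<ge>clen w. tdrop ((tu ^^ m) w) = 0"
    using tdrop_funpow_eq_0 by blast
  then have "\<forall>m\<ge>tu_rank w. tdrop ((tu ^^ m) w) = 0"
    unfolding tu_rank_def by (rule LeastI)
  then show "m \<ge> tu_rank w \<Longrightarrow> tdrop ((tu ^^ m) w) = 0"
    by blast
qed

lemma sg_rank_sg: "sg_rank (sg w) \<le> sg_rank w - 1"
proof (rule sg_rank_le)
  fix m assume "m \<ge> sg_rank w - 1"
  then have "sdrop ((sg ^^ Suc m) w) = 0"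
    by (intro sg_rank) linarith
  then show "sdrop ((sg ^^ m) (sg w)) = 0"
    by (simp add: funpow_swap1)
qed

lemma tu_rank_tu: "tu_rank (tu w) \<le> tu_rank w - 1"
  using sg_rank_sg[of "sw w"] by (simp add: sg_sw sg_rank_sw)

text \<open>If no b-letter is used up, the image has no equal adjacent a-letters, so its a-runs have
  length one; where w has no a-run between turns, none arises.\<close>

lemma tu_rank_sg_le_1:
  assumes "sdrop w = 0"
  shows "tu_rank (sg w) \<le> min 1 (tu_rank w)"
proof (cases "tu_rank w = 0")
  case True
  then have "tdrop w = 0"
    using tu_rank[of w 0] by simp
  then show ?thesis
    using tu_rank_le[of 0 "sg w"] tdrop_funpow_sg_eq_0 by simp
next
  case False
  have "tu_rank (sg w) \<le> 1"
  proof (rule tu_rank_le)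
    fix m :: nat assume "m \<ge> 1"
    then show "tdrop ((tu ^^ m) (sg w)) = 0"
      using tdrop_funpow_sg_le[of m w] assms by auto
  qed
  with False show ?thesis
    by simp
qed

lemma sg_rank_tu_le_1: "tdrop w = 0 \<Longrightarrow> sg_rank (tu w) \<le> min 1 (sg_rank w)"
  using tu_rank_sg_le_1[of "sw w"] by (simp add: sg_sw tu_rank_sw sdrop_sw)

text \<open>When \<open>sg\<close> loses turns, a-runs between turns may grow, but their rank stays
  at most the number of lost turns. Weight 2 on the turns keeps the drop strict despite this
  growth.\<close>

definition mu :: "letter list \<Rightarrow> int" where
  "mu w = 2 * turns w + int (tu_rank w) + int (sg_rank w)"

lemma mu_sw: "mu (sw w) = mu w"
  by (simp add: mu_def turns_sw tu_rank_sw sg_rank_sw)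

lemma mu_nonneg: "mu w \<ge> 0"
  using turns_nonneg[of w] by (simp add: mu_def)

lemma mu_le: "mu w \<le> 4 * int (clen w)"
proof -
  have "sg_rank w \<le> clen w" "tu_rank w \<le> clen w"
    using sg_rank_le sdrop_funpow_eq_0 tu_rank_le tdrop_funpow_eq_0 by blast+
  then show ?thesis
    using turns_le[of w] by (simp add: mu_def)
qed

text \<open>Pure runs (powers of one generator between two turns) are the only parts of a cyclic
  word that can make turns disappear.  If the measure does not drop under sg, then no
  pure run of the letter b exists and the pure runs of the letter a have length one.\<close>

lemma mu_sg:
  "mu (sg w) < mu w \<or> mu (sg w) = mu w \<and> sg_rank w = 0 \<and> tu_rank w \<le> 1"
proof (cases "sdrop w = 0")
  case True
  then have "turns (sg w) = turns w"
    by (simp add: sdrop_def)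
  then show ?thesis
    using sg_rank_sg[of w] tu_rank_sg_le_1[OF True] by (auto simp: mu_def)
next
  case False
  then have pos: "sdrop w > 0"
    using sdrop_nonneg[of w] by simp
  have "tu_rank (sg w) \<le> nat (sdrop w)"
  proof (rule tu_rank_le)
    fix m assume "m \<ge> nat (sdrop w)"
    then show "tdrop ((tu ^^ m) (sg w)) = 0"
      using tdrop_funpow_sg_le[of m w] pos by linarith
  qed
  then show ?thesis
    using sg_rank_sg[of w] pos by (auto simp: mu_def sdrop_def)
qed

section \<open>Turn numbers along products of Nielsen maps\<close>

definition nielsen :: "bool \<Rightarrow> letter list \<Rightarrow> letter list" where
  "nielsen s w = (if s then sg w else tu w)"

lemma nielsen_simps [simp]: "nielsen True = sg" "nielsen False = tu"
  by (simp_all add: nielsen_def fun_eq_iff)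

definition nielsens :: "bool list \<Rightarrow> letter list \<Rightarrow> letter list" where
  "nielsens P w = foldl (\<lambda>x s. nielsen s x) w P"

lemma nielsens_simps [simp]:
  "nielsens [] w = w" "nielsens (s # P) w = nielsens P (nielsen s w)"
  by (simp_all add: nielsens_def)

lemma nielsens_snoc: "nielsens (P @ [s]) w = nielsen s (nielsens P w)"
  by (simp add: nielsens_def)

lemma nielsen_sw: "nielsen s (sw w) = sw (nielsen (\<not> s) w)"
  by (cases s) (simp_all add: sg_sw tu_sw)

lemma nielsens_sw: "nielsens P (sw w) = sw (nielsens (map Not P) w)"
  by (induction P arbitrary: w) (auto simp: nielsen_sw)

text \<open>With no run between two turns nothing can be used up, and neither map creates such a
  run.\<close>

lemma turns_nielsens_mixed:
  "sg_rank w = 0 \<Longrightarrow> tu_rank w = 0 \<Longrightarrow> turns (nielsens P w) = turns w"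
proof (induction P arbitrary: w)
  case (Cons s P)
  have 0: "sdrop w = 0" "tdrop w = 0"
    using sg_rank[of w 0] tu_rank[of w 0] Cons.prems by simp_all
  have "sg_rank (nielsen s w) = 0" "tu_rank (nielsen s w) = 0"
    using sg_rank_sg[of w] tu_rank_tu[of w] tu_rank_sg_le_1[OF 0(1)] sg_rank_tu_le_1[OF 0(2)]
      Cons.prems by (cases s; simp)+
  then have "turns (nielsens P (nielsen s w)) = turns (nielsen s w)"
    by (rule Cons.IH)
  then show ?case
    using 0 by (cases s) (simp_all add: sdrop_def tdrop_def)
qed simp

text \<open>The hypotheses persist under \<open>sg\<close>, which then changes no turn number. The
  first \<open>tu\<close> uses up all a-runs between turns, equally many with or without the extra
  \<open>sg\<close> by \<open>tdrop_sg_eq\<close>; afterwards the turn number is constant.\<close>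

lemma turns_nielsens_sg:
  "sg_rank w = 0 \<Longrightarrow> tu_rank w \<le> 1 \<Longrightarrow> turns (nielsens P (sg w)) = turns (nielsens P w)"
proof (induction P arbitrary: w)
  case Nil
  then show ?case
    using sg_rank[of w 0] by (simp add: sdrop_def)
next
  case (Cons s P)
  have 0: "sdrop w = 0"
    using sg_rank[of w 0] Cons.prems by simp
  have sg: "sg_rank (sg w) = 0" "tu_rank (sg w) \<le> 1"
    using sg_rank_sg[of w] tu_rank_sg_le_1[OF 0] Cons.prems by simp_all
  then have sg0: "sdrop (sg w) = 0"
    using sg_rank[of "sg w" 0] by simp
  show ?case
  proof (cases s)
    case True
    then show ?thesis
      using Cons.IH[OF sg] by simp
  next
    case False
    have tu: "turns (nielsens P (tu x)) = turns (tu x)"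
      if x: "tu_rank x \<le> 1" "sdrop x = 0" for x
    proof (rule turns_nielsens_mixed)
      show "sg_rank (tu x) = 0"
        using sg_rank_le[of 0 "tu x"] sdrop_funpow_tu_eq_0[OF x(2)] by simp
      show "tu_rank (tu x) = 0"
        using tu_rank_tu[of x] x(1) by simp
    qed
    have "turns (tu (sg w)) = turns (tu w)"
      using tdrop_sg_eq[OF 0] 0 by (simp add: tdrop_def sdrop_def)
    then show ?thesis
      using False tu[OF sg(2) sg0] tu[OF Cons.prems(2) 0] by simp
  qed
qed

lemma mu_nielsen:
  "mu (nielsen s w) < mu w \<or>
   mu (nielsen s w) = mu w \<and> (\<forall>P. turns (nielsens P (nielsen s w)) = turns (nielsens P w))"
proof (cases s)
  case True
  then show ?thesis
    using mu_sg[of w] turns_nielsens_sg[of w] by auto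
next
  case False
  have "turns (nielsens P (tu w)) = turns (nielsens P w)" if "tu_rank w = 0" "sg_rank w \<le> 1" for P
    using turns_nielsens_sg[of "sw w" "map Not P"] that
    by (simp add: sg_rank_sw tu_rank_sw sg_sw nielsens_sw turns_sw comp_def)
  then show ?thesis
    using False mu_sg[of "sw w"] by (auto simp: sg_sw mu_sw sg_rank_sw tu_rank_sw)
qed

text \<open>If neither measure drops at the leading map, that map does not influence later turn
  numbers and is omitted. Otherwise it is kept: one measure drops and the other does not grow, so
  the sum pays for it.\<close>

lemma turns_differ_bounded:
  "turns (nielsens P u) \<noteq> turns (nielsens P v) \<Longrightarrow>
   \<exists>Q. int (length Q) \<le> mu u + mu v \<and> turns (nielsens Q u) \<noteq> turns (nielsens Q v)"
proof (induction P arbitrary: u v)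
  case Nil
  then show ?case
    using mu_nonneg[of u] mu_nonneg[of v] by (intro exI[of _ "[]"]) auto
next
  case (Cons s P)
  then obtain Q where Q: "int (length Q) \<le> mu (nielsen s u) + mu (nielsen s v)"
    "turns (nielsens Q (nielsen s u)) \<noteq> turns (nielsens Q (nielsen s v))"
    by auto
  show ?case
  proof (cases "mu (nielsen s u) = mu u \<and> mu (nielsen s v) = mu v")
    case True
    then show ?thesis
      using Q mu_nielsen[of s u] mu_nielsen[of s v] by (intro exI[of _ Q]) auto
  next
    case False
    then show ?thesis
      using Q mu_nielsen[of s u] mu_nielsen[of s v] by (intro exI[of _ "s # Q"]) auto
  qed
qed

text \<open>By \<open>mu_le\<close> a difference in turns would show within 4 |u| + 4 |v| maps. One
  more map is needed to read turn numbers off from lengths.\<close>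

lemma clen_nielsens_eqI:
  assumes bounded: "\<And>P. length P \<le> 4 * length u + 4 * length v + 1 \<Longrightarrow>
    clen (nielsens P u) = clen (nielsens P v)"
  shows "clen (nielsens P u) = clen (nielsens P v)"
proof -
  have turns_bounded: "turns (nielsens P u) = turns (nielsens P v)"
    if "length P \<le> 4 * length u + 4 * length v" for P
    using bounded[of P] bounded[of "P @ [True]"] bounded[of "P @ [False]"] that
    by (simp add: nielsens_snoc turns_def)
  have turns: "turns (nielsens P u) = turns (nielsens P v)" for P
  proof (rule ccontr)
    assume "turns (nielsens P u) \<noteq> turns (nielsens P v)"
    then obtain Q where Q: "int (length Q) \<le> mu u + mu v"
      "turns (nielsens Q u) \<noteq> turns (nielsens Q v)"
      using turns_differ_bounded by blast
    have "length Q \<le> 4 * length u + 4 * length v"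
      using Q(1) mu_le[of u] mu_le[of v] clen_le[of u] clen_le[of v] by linarith
    then show False
      using turns_bounded Q(2) by blast
  qed
  have "num_a (nielsens P u) = num_a (nielsens P v) \<and> num_b (nielsens P u) = num_b (nielsens P v)"
  proof (induction P rule: rev_induct)
    case Nil
    then show ?case
      using bounded[of "[]"] bounded[of "[True]"] bounded[of "[False]"] turns[of "[]"]
      by (simp add: num_a_def num_b_def)
  next
    case (snoc s P)
    then show ?case
      using turns[of P] by (cases s) (simp_all add: nielsens_snoc num_sg num_tu)
  qed
  then show ?thesis
    using clen_eq_num[of "nielsens P u"] clen_eq_num[of "nielsens P v"] by linarith
qed

section \<open>Automorphisms of the free group of rank two\<close>

lemma ext_cong_freq:
  assumes "x \<approx> x'" "y \<approx> y'"
  shows "ext x y w \<approx> ext x' y' w"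
proof (induction w)
  case (Cons l w)
  have "letter_image x y l \<approx> letter_image x' y' l"
    using assms by (cases "(x, y, l)" rule: letter_image.cases) (auto intro: freq_finv)
  then show ?case
    unfolding ext_Cons using Cons by (intro freq_append)
qed simp

lemma ext_conjugate: "ext (g @ x @ finv g) (g @ y @ finv g) w \<approx> g @ ext x y w @ finv g"
proof (induction w)
  case Nil
  then show ?case
    using freq_sym[OF freq_finv_right[of g]] by simp
next
  case (Cons l w)
  have "letter_image (g @ x @ finv g) (g @ y @ finv g) l = g @ letter_image x y l @ finv g"
    by (cases "(x, y, l)" rule: letter_image.cases) auto
  then have "ext (g @ x @ finv g) (g @ y @ finv g) (l # w) \<approx>
      (g @ letter_image x y l @ finv g) @ (g @ ext x y w @ finv g)"
    unfolding ext_Cons using Cons by (intro freq_append) simp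
  also have "\<dots> = (g @ letter_image x y l) @ finv g @ g @ (ext x y w @ finv g)"
    by simp
  also have "\<dots> \<approx> (g @ letter_image x y l) @ (ext x y w @ finv g)"
    by (rule freq_mid_finv_left)
  finally show ?case
    by (simp add: ext_Cons)
qed

lemma ext_fconj_conjugate:
  assumes "x' \<approx> g @ x @ finv g" "y' \<approx> g @ y @ finv g"
  shows "ext x' y' w \<sim> ext x y w"
  using ext_cong_freq[OF assms] ext_conjugate freq_trans fconjI by blast

lemma nielsen_fconj: "u \<sim> v \<Longrightarrow> nielsen s u \<sim> nielsen s v"
  by (cases s) (simp_all add: ext_fconj)

lemma nielsens_fconj: "u \<sim> v \<Longrightarrow> nielsens P u \<sim> nielsens P v"
  by (induction P arbitrary: u v) (auto intro: nielsen_fconj)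

section \<open>Test maps: an optional sign change, then positive Nielsen maps\<close>

abbreviation "ng \<equiv> ext [(GA, True)] [(GB, True)]"

lemma clen_letters:
  assumes "fst c \<noteq> fst d"
  shows "clen (ext [c] [d] w) = clen w"
proof -
  have fst: "fst d = other (fst c)"
    using assms by (cases "fst c"; cases "fst d") auto
  define h where "h x = (case x of (GA, s) \<Rightarrow> (if s then inv_l c else c) | (GB, s) \<Rightarrow> (if s then inv_l d else d))" for x
  have h: "letter_image [c] [d] x = [h x]" for x
    by (cases "([c], [d], x)" rule: letter_image.cases) (auto simp: h_def)
  then have map: "ext [c] [d] w = map h w" for w
    by (induction w) (auto simp: ext_Cons)
  have inv: "h (inv_l x) = inv_l (h x)" for x
    by (cases x; cases "fst x") (auto simp: h_def inv_l_def)
  have "inj h"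
  proof (rule injI)
    fix x y assume "h x = h y"
    then show "x = y"
      using fst by (cases x; cases y; cases "fst x"; cases "fst y")
        (auto simp: h_def inv_l_def prod_eq_iff split: if_splits)
  qed
  obtain r where r: "is_rep w r"
    using exists_rep by blast
  then have "w \<sim> r" "cyclically_reduced (map h r)"
    by (simp_all add: is_rep_def cyclically_reduced_map[OF inv \<open>inj h\<close>])
  then have "is_rep (ext [c] [d] w) (map h r)"
    unfolding is_rep_def using ext_fconj[of w r "[c]" "[d]"] by (simp only: map[of r])
  then show ?thesis
    using is_rep_length[OF r] is_rep_length by fastforce
qed

text \<open>The composites of \<open>ng\<close> and \<open>sg\<close> send a to b^-1 a^-1 and to
  a^-1 b^-1 and agree on b, so conjugation by b^-1 matches them. For \<open>tu\<close> conjugation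
  by a^-1 does the same.\<close>

lemma nielsen_ng: "nielsen s (ng w) \<sim> ng (nielsen s w)"
proof (cases s)
  case True
  have "ext [(GB, True), (GA, True)] [(GB, True)] w \<sim> ext [(GA, True), (GB, True)] [(GB, True)] w"
    by (rule ext_fconj_conjugate[of _ "[(GB, True)]"]) (simp_all add: freq_def reduce_Cons inv_l_def)
  then show ?thesis
    using True by (simp add: ext_ext ext_Cons inv_l_def)
next
  case False
  have "ext [(GA, True)] [(GA, True), (GB, True)] w \<sim> ext [(GA, True)] [(GB, True), (GA, True)] w"
    by (rule ext_fconj_conjugate[of _ "[(GA, True)]"]) (simp_all add: freq_def reduce_Cons inv_l_def)
  then show ?thesis
    using False by (simp add: ext_ext ext_Cons inv_l_def)
qed

lemma nielsens_ng: "nielsens P (ng w) \<sim> ng (nielsens P w)"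
proof (induction P arbitrary: w)
  case (Cons s P)
  have "nielsens P (nielsen s (ng w)) \<sim> nielsens P (ng (nielsen s w))"
    by (intro nielsens_fconj nielsen_ng)
  also have "\<dots> \<sim> ng (nielsens P (nielsen s w))"
    by (rule Cons.IH)
  finally show ?case
    by simp
qed simp

lemma clen_nielsens_ng: "clen (nielsens P (ng w)) = clen (nielsens P w)"
  using clen_fconj[OF nielsens_ng] clen_letters by simp

lemma clen_nielsens_sw: "clen (nielsens P (sw w)) = clen (nielsens (map Not P) w)"
  by (simp add: nielsens_sw clen_sw)

definition flip_nielsens :: "bool \<Rightarrow> bool list \<Rightarrow> letter list \<Rightarrow> letter list" where
  "flip_nielsens d P w = nielsens P (if d then fl w else w)"

text \<open>Agreement on all test maps. Its invariance under \<open>fl\<close>, \<open>sw\<close>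
  and \<open>sg\<close> lets the elementary steps of Nielsen reduction act on the argument
  words.\<close>

definition nequiv :: "letter list \<Rightarrow> letter list \<Rightarrow> bool" where
  "nequiv u v \<longleftrightarrow> (\<forall>d P. clen (flip_nielsens d P u) = clen (flip_nielsens d P v))"

lemma nequivI:
  assumes "\<And>d P. \<exists>d' P'. \<forall>w. clen (flip_nielsens d P (f w)) = clen (flip_nielsens d' P' w)"
    and "nequiv u v"
  shows "nequiv (f u) (f v)"
  using assms unfolding nequiv_def by metis

lemma nequiv_fl: "nequiv u v \<Longrightarrow> nequiv (fl u) (fl v)"
proof (rule nequivI[of fl])
  fix d P
  show "\<exists>d' P'. \<forall>w. clen (flip_nielsens d P (fl w)) = clen (flip_nielsens d' P' w)"
    by (intro exI[of _ "\<not> d"] exI[of _ P]) (simp add: flip_nielsens_def ext_ext ext_Cons inv_l_def ext_id)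
qed

text \<open>Moving \<open>fl\<close> past \<open>sw\<close> costs only \<open>ng\<close>, which
  leaves cyclic lengths alone; \<open>sw\<close> then passes through the product by exchanging its
  factors.\<close>

lemma nequiv_sw: "nequiv u v \<Longrightarrow> nequiv (sw u) (sw v)"
proof (rule nequivI[of sw])
  fix d P
  have "fl (sw w) = sw (ng (fl w))" for w
    by (simp add: ext_ext ext_Cons inv_l_def)
  then show "\<exists>d' P'. \<forall>w. clen (flip_nielsens d P (sw w)) = clen (flip_nielsens d' P' w)"
    by (intro exI[of _ d] exI[of _ "map Not P"])
       (simp add: flip_nielsens_def clen_nielsens_sw clen_nielsens_ng)
qed

text \<open>A sign change between \<open>sg\<close> and the product P has to be removed or moved. Up
  to free reduction, sg fl sg = fl and tu fl sg = sw ng tu, where \<open>sw\<close> and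
  \<open>ng\<close> are absorbed; for empty P the sign change preserves the length.\<close>

lemma nequiv_sg: "nequiv u v \<Longrightarrow> nequiv (sg u) (sg v)"
proof (rule nequivI[of sg])
  fix d P
  show "\<exists>d' P'. \<forall>w. clen (flip_nielsens d P (sg w)) = clen (flip_nielsens d' P' w)"
  proof (cases d)
    case False
    then show ?thesis
      by (intro exI[of _ False] exI[of _ "True # P"]) (simp add: flip_nielsens_def)
  next
    case True
    show ?thesis
    proof (cases P)
      case Nil
      then show ?thesis
        using True clen_letters[of "(GA, False)" "(GB, True)"]
        by (intro exI[of _ False] exI[of _ "[True]"]) (simp add: flip_nielsens_def)
    next
      case (Cons s P')
      show ?thesis
      proof (cases s)
        case True
        have "sg (fl (sg w)) \<approx> fl w" for w
          unfolding ext_ext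
          by (rule ext_cong_freq) (simp_all add: ext_Cons freq_def reduce_Cons inv_l_def)
        then have "clen (nielsens P' (sg (fl (sg w)))) = clen (nielsens P' (fl w))" for w
          by (intro clen_fconj nielsens_fconj freq_imp_fconj)
        then show ?thesis
          using \<open>d\<close> True Cons by (intro exI[of _ True] exI[of _ P']) (simp add: flip_nielsens_def)
      next
        case False
        have "tu (fl (sg w)) \<approx> sw (ng (tu w))" for w
          unfolding ext_ext
          by (rule ext_cong_freq) (simp_all add: ext_Cons freq_def reduce_Cons inv_l_def)
        then have "clen (nielsens P' (tu (fl (sg w)))) = clen (nielsens P' (sw (ng (tu w))))" for w
          by (intro clen_fconj nielsens_fconj freq_imp_fconj)
        then show ?thesis
          using \<open>d\<close> False Cons by (intro exI[of _ False] exI[of _ "False # map Not P'"])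
            (simp add: flip_nielsens_def clen_nielsens_sw clen_nielsens_ng)
      qed
    qed
  qed
qed

section \<open>Elementary changes of a generating pair\<close>

definition generates :: "letter list \<Rightarrow> letter list \<Rightarrow> bool" where
  "generates x y \<longleftrightarrow> (\<forall>z. \<exists>w. ext x y w \<approx> z)"

text \<open>The induction hypothesis of Nielsen reduction: test maps decide whether lengths agree
  under the endomorphism with images x and y.\<close>

definition settles :: "letter list \<Rightarrow> letter list \<Rightarrow> bool" where
  "settles x y \<longleftrightarrow> (generates x y \<longrightarrow> (\<forall>u v. nequiv u v \<longrightarrow> clen (ext x y u) = clen (ext x y v)))"

text \<open>An elementary change of the pair is compensated by a map f on argument words;
  simultaneous conjugation by g is invisible to \<open>clen\<close>.\<close>

lemma settles_reduction:
  assumes res: "settles x' y'"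
    and g: "\<And>w. ext x y w \<approx> g @ ext x' y' (f w) @ finv g"
    and f: "\<And>u v. nequiv u v \<Longrightarrow> nequiv (f u) (f v)"
  shows "settles x y"
  unfolding settles_def
proof (intro impI allI)
  fix u v
  assume gen: "generates x y" and "nequiv u v"
  have "generates x' y'"
    unfolding generates_def
  proof
    fix z
    obtain w where "ext x y w \<approx> g @ z @ finv g"
      using gen unfolding generates_def by blast
    then have base: "g @ ext x' y' (f w) @ finv g \<approx> g @ z @ finv g"
      using g freq_sym freq_trans by blast
    have eq: "finv g @ (g @ ext x' y' (f w) @ finv g) @ g \<approx> finv g @ (g @ z @ finv g) @ g"
      by (rule freq_append[OF freq_refl freq_append[OF base freq_refl]])
    have cancel: "finv g @ (g @ t @ finv g) @ g \<approx> t" for t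
      using freq_mid_finv_left[of "[]" g "t @ finv g @ g"] freq_mid_finv_left[of t g "[]"]
      by (simp add: freq_def)
    have "ext x' y' (f w) \<approx> z"
      by (rule freq_trans[OF freq_sym[OF cancel] freq_trans[OF eq cancel]])
    then show "\<exists>w. ext x' y' w \<approx> z"
      by blast
  qed
  then have "clen (ext x' y' (f u)) = clen (ext x' y' (f v))"
    using res f[OF \<open>nequiv u v\<close>] unfolding settles_def by blast
  moreover have "clen (ext x y w) = clen (ext x' y' (f w))" for w
    using g[of w] by (intro clen_fconj fconjI)
  ultimately show "clen (ext x y u) = clen (ext x y v)"
    by simp
qed

lemma settles_swap: "settles y x \<Longrightarrow> settles x y"
  by (rule settles_reduction[of y x _ _ "[]" sw]) (auto simp: ext_ext ext_Cons intro: nequiv_sw)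

lemma settles_finv_right: "settles x (finv y) \<Longrightarrow> settles x y"
  by (rule settles_reduction[of x "finv y" _ _ "[]" fl]) (auto simp: ext_ext ext_Cons intro: nequiv_fl)

lemma settles_finv_left: "settles (finv x) y \<Longrightarrow> settles x y"
  by (rule settles_swap, rule settles_finv_right, rule settles_swap)

text \<open>Here x = (x y) y^-1, and \<open>fl (sg (fl w))\<close> realizes a -> a b^-1 on argument
  words.\<close>

lemma settles_mult_right:
  assumes "settles (x @ y) y"
  shows "settles x y"
proof (rule settles_reduction[OF assms, of _ _ "[]" "\<lambda>w. fl (sg (fl w))"])
  fix w
  have "ext x y w \<approx> ext (x @ y @ finv y) y w"
    using freq_mid_finv_right[of x y "[]"] by (intro ext_cong_freq) (simp_all add: freq_sym)
  then show "ext x y w \<approx> [] @ ext (x @ y) y (fl (sg (fl w))) @ finv []"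
    by (simp add: ext_ext ext_Cons inv_l_def)
qed (intro nequiv_fl nequiv_sg)

lemma settles_freq:
  assumes "settles x' y'" "x \<approx> x'" "y \<approx> y'"
  shows "settles x y"
  by (rule settles_reduction[OF assms(1), of _ _ "[]" "\<lambda>w. w"])
     (use ext_cong_freq[OF assms(2,3)] in simp_all)

lemma settles_conjugate:
  assumes "settles x' y'" "x \<approx> g @ x' @ finv g" "y \<approx> g @ y' @ finv g"
  shows "settles x y"
  by (rule settles_reduction[OF assms(1), of _ _ g "\<lambda>w. w"])
     (use ext_cong_freq[OF assms(2,3)] ext_conjugate freq_trans in blast)+

lemma settles_letter_image:
  assumes "settles (letter_image x y l) (letter_image x y m)" "fst l \<noteq> fst m"
  shows "settles x y"
proof -
  have "settles x y" if "fst l = GA" "fst m = GB"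
    "settles (letter_image x y l) (letter_image x y m)" for l m
    using that by (cases l; cases m) (auto split: if_splits intro: settles_finv_left settles_finv_right)
  moreover have "settles (letter_image x y m) (letter_image x y l)"
    by (rule settles_swap) (rule assms(1))
  ultimately show ?thesis
    using assms by (cases "fst l"; cases "fst m") auto
qed

lemma cancellation:
  "reduced u \<Longrightarrow> reduced v \<Longrightarrow> \<exists>p r q. u = p @ r \<and> v = finv r @ q \<and> reduced (p @ q)"
proof (induction u arbitrary: v rule: rev_induct)
  case Nil
  then show ?case
    by (intro exI[of _ "[]"] exI[of _ "[]"] exI[of _ v]) simp
next
  case (snoc x u)
  show ?case
  proof (cases "v \<noteq> [] \<and> hd v = inv_l x")
    case True
    then obtain v' where v: "v = inv_l x # v'"
      by (cases v) auto
    then obtain p r q where "u = p @ r" "v' = finv r @ q" "reduced (p @ q)"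
      using snoc.IH[of v'] snoc.prems by (auto simp: reduced_append reduced_Cons)
    then show ?thesis
      using v by (intro exI[of _ p] exI[of _ "r @ [x]"] exI[of _ q]) simp
  next
    case False
    then have "reduced ((u @ [x]) @ v)"
      using snoc.prems unfolding reduced_append[of "u @ [x]" v] by auto
    then show ?thesis
      by (intro exI[of _ "u @ [x]"] exI[of _ "[]"] exI[of _ v]) simp
  qed
qed

lemma reduce_cancellation:
  assumes "reduced (p @ q)"
  shows "reduce ((p @ r) @ (finv r @ q)) = p @ q"
proof -
  have "(p @ r) @ (finv r @ q) \<approx> p @ q"
    using freq_mid_finv_right[of p r q] by simp
  then show ?thesis
    using assms by (simp add: freq_def)
qed

lemma clen_pos:
  assumes "reduced u" "u \<noteq> []"
  shows "clen u > 0"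
proof -
  obtain g c where "reduce u = g @ c @ finv g" "cyclically_reduced c" "u \<approx> g @ c @ finv g"
    "clen u = length c"
    by (rule clen_decomposition)
  moreover have "\<not> u \<approx> g @ finv g"
    using freq_finv_right[of g] assms by (auto simp: freq_def)
  ultimately show ?thesis
    by auto
qed

lemma length_reduce_finv: "length (reduce (finv w)) = length (reduce w)"
proof -
  have "finv w \<approx> finv (reduce w)"
    by (intro freq_finv freq_sym[OF freq_reduce])
  then show ?thesis
    by (simp add: freq_def)
qed

text \<open>N1 and N2 are the Nielsen conditions, in rank two; under them a product of basis elements
  keeps a nonempty part of each of its factors.  Conjugating both basis elements is allowed here,
  so the usual ordering of the initial halves is not needed to achieve N2.\<close>

locale nielsen_reduced =
  fixes x y :: "letter list"
  assumes red: "reduced x" "reduced y" and nonempty: "x \<noteq> []" "y \<noteq> []"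
    and N1: "fst l \<noteq> fst m \<Longrightarrow>
      length (letter_image x y l) \<le> length (reduce (letter_image x y l @ letter_image x y m))"
    and N2: "fst l \<noteq> fst m \<Longrightarrow> letter_image x y m = p @ q \<Longrightarrow> length p = length q \<Longrightarrow>
      letter_image x y l \<noteq> finv q @ z @ finv p"
begin

abbreviation "img \<equiv> letter_image x y"

lemma reduced_img: "reduced (img l)"
  using red by (cases "(x, y, l)" rule: letter_image.cases) auto

lemma img_nonempty: "img l \<noteq> []"
  using nonempty by (cases "(x, y, l)" rule: letter_image.cases) auto

lemma N1_right:
  assumes "fst l \<noteq> fst m"
  shows "length (img m) \<le> length (reduce (img l @ img m))"
proof -
  have "length (img (inv_l m)) \<le> length (reduce (img (inv_l m) @ img (inv_l l)))"
    using assms by (intro N1) (simp add: inv_l_def)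
  also have "img (inv_l m) @ img (inv_l l) = finv (img l @ img m)"
    by (simp add: letter_image_inv_l)
  finally show ?thesis
    using length_reduce_finv[of "img l @ img m"] by (simp add: letter_image_inv_l)
qed

definition cancelled :: "letter \<Rightarrow> letter \<Rightarrow> nat" where
  "cancelled l m = (length (img l) + length (img m) - length (reduce (img l @ img m))) div 2"

lemma cancelledE:
  obtains p r q where "img l = p @ r" "img m = finv r @ q" "reduced (p @ q)" "length r = cancelled l m"
proof -
  obtain p r q where pq: "img l = p @ r" "img m = finv r @ q" "reduced (p @ q)"
    using cancellation reduced_img by metis
  have "reduce (img l @ img m) = p @ q"
    unfolding pq(1,2) by (rule reduce_cancellation[OF pq(3)])
  then have "length r = cancelled l m"
    by (simp add: cancelled_def pq)
  then show ?thesis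
    using that pq by blast
qed

text \<open>For different generators this is N1 from both sides. For m = l, the square is longer
  than the factor by its cyclic length, which is positive, hence the strict bound.\<close>

lemma cancelled_le:
  assumes "m \<noteq> inv_l l"
  shows "2 * cancelled l m \<le> length (img l)" "2 * cancelled l m \<le> length (img m)"
    "m = l \<Longrightarrow> 2 * cancelled l m < length (img l)"
proof -
  have self: "2 * cancelled l m < length (img l)" if "m = l"
  proof -
    have "length (reduce (img l @ img l)) = length (img l) + clen (img l)"
      using clen_double[of "img l"] reduced_img[of l] by simp
    moreover have "clen (img l) > 0"
      by (rule clen_pos[OF reduced_img img_nonempty])
    moreover have "length (img l) > 0"
      using img_nonempty by simp
    ultimately show ?thesis
      unfolding cancelled_def that by linarith
  qed
  then show "m = l \<Longrightarrow> 2 * cancelled l m < length (img l)" .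
  have "m = l \<or> fst l \<noteq> fst m"
    using assms by (auto simp: inv_l_def prod_eq_iff)
  then show "2 * cancelled l m \<le> length (img l)" "2 * cancelled l m \<le> length (img m)"
    using self N1[of l m] N1_right[of l m] by (auto simp: cancelled_def)
qed

text \<open>Otherwise the neighbours l and n consume exactly one half of m each. In rank two they
  are then equal or inverse to each other: n = l contradicts N2, and n = l^-1 makes the halves of m
  mutually inverse, so m would be trivial.\<close>

lemma cancelled_add_less:
  assumes lm: "m \<noteq> inv_l l" and mn: "n \<noteq> inv_l m"
  shows "cancelled l m + cancelled m n < length (img m)"
proof (rule ccontr)
  assume "\<not> cancelled l m + cancelled m n < length (img m)"
  then have half: "2 * cancelled l m = length (img m)" "2 * cancelled m n = length (img m)"
    using cancelled_le(2)[OF lm] cancelled_le(1)[OF mn] by linarith+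
  have "l \<noteq> m" "n \<noteq> m"
    using half cancelled_le(3)[OF lm] cancelled_le(3)[OF mn] by auto
  then have "fst l \<noteq> fst m" "fst n \<noteq> fst m"
    using lm mn by (auto simp: inv_l_def prod_eq_iff)
  then have "fst l = fst n"
    by (cases "fst l"; cases "fst m"; cases "fst n") auto
  obtain p1 r1 q1 where 1: "img l = p1 @ r1" "img m = finv r1 @ q1" "length r1 = cancelled l m"
    using cancelledE[of l m] by metis
  obtain p2 r2 q2 where 2: "img m = p2 @ r2" "img n = finv r2 @ q2" "length r2 = cancelled m n"
    using cancelledE[of m n] by metis
  have len: "length (finv r1) = length p2" "length p2 = length r2"
    using half 1 2 by (simp_all add: 2(1))
  have p2: "p2 = finv r1"
    using 1(2) 2(1) len(1) by (metis append_eq_append_conv)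
  show False
  proof (cases "n = l")
    case True
    \<comment> \<open>The pieces at the two ends of \<open>img l\<close> do not overlap, since each
      is at most half of it.\<close>
    have le: "length (finv r2) \<le> length p1"
      using cancelled_le(1)[OF lm] 1(1,3) 2(3) half by simp
    have "p1 @ r1 = finv r2 @ q2"
      using 1(1) 2(2) True by simp
    then obtain z where "p1 = finv r2 @ z \<or> p1 @ z = finv r2"
      by (auto simp: append_eq_append_conv2)
    moreover have "z = []" if "p1 @ z = finv r2"
      using le arg_cong[OF that, of length] by (simp flip: length_0_conv)
    ultimately have "\<exists>z. p1 = finv r2 @ z"
      by auto
    then obtain z where "img l = finv r2 @ z @ r1"
      using 1(1) by auto
    then show False
      using N2[OF \<open>fst l \<noteq> fst m\<close> 2(1) len(2), of z] unfolding p2 finv_finv by blast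
  next
    case False
    then have n: "n = inv_l l"
      using \<open>fst l = fst n\<close> by (auto simp: inv_l_def prod_eq_iff)
    have "finv r2 @ q2 = finv r1 @ finv p1"
      using 1(1) 2(2) unfolding n letter_image_inv_l by simp
    then have "finv r2 = finv r1"
      using 1(3) 2(3) half by (simp add: append_eq_append_conv)
    then have "img m = p2 @ finv p2"
      using 2(1) p2 by (metis finv_finv)
    then have "img m \<approx> []"
      using freq_finv_right[of p2] by simp
    then show False
      using reduced_img[of m] img_nonempty[of m] by (simp add: freq_def)
  qed
qed

text \<open>Invariant for appending factors: of the last factor, k letters have been cancelled on
  the left, and whatever admissible letter follows, something of it remains. So cancellation never
  reaches earlier factors, and appending never shortens the product.\<close>

lemma reduce_ext:
  assumes "reduced w" "w \<noteq> []"
  shows "\<exists>h k. reduce (ext x y w) = h @ drop k (img (last w)) \<and>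
    (\<forall>n. n \<noteq> inv_l (last w) \<longrightarrow> k + cancelled (last w) n < length (img (last w))) \<and>
    (w \<noteq> [last w] \<longrightarrow> length (reduce (ext x y (butlast w))) \<le> length (reduce (ext x y w)))"
  using assms
proof (induction w rule: rev_induct)
  case Nil
  then show ?case by simp
next
  case (snoc n w)
  show ?case
  proof (cases "w = []")
    case True
    have "length (img n) > 0"
      using img_nonempty by simp
    then have "cancelled n n' < length (img n)" if "n' \<noteq> inv_l n" for n'
      using cancelled_le(1)[OF that] by linarith
    then show ?thesis
      using True reduced_img[of n]
      by (intro exI[of _ "[]"] exI[of _ 0]) (simp add: ext_def)
  next
    case False
    define m where "m = last w"
    have n: "n \<noteq> inv_l m" "reduced w"
      using snoc.prems False by (auto simp: reduced_append m_def)
    then obtain h k where h: "reduce (ext x y w) = h @ drop k (img m)"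
      and k: "\<And>n. n \<noteq> inv_l m \<Longrightarrow> k + cancelled m n < length (img m)"
      using snoc.IH False unfolding m_def by blast
    obtain p r q where pr: "img m = p @ r" "img n = finv r @ q" "reduced (p @ q)"
      "length r = cancelled m n"
      using cancelledE by metis
    have "k < length p"
      using k[OF n(1)] pr by simp
    then have drop: "drop k (img m) = drop k p @ r" and ne: "drop k p \<noteq> []"
      by (simp_all add: pr)
    have "reduced (h @ drop k p @ r)"
      using reduced_reduce[of "ext x y w"] by (simp add: h drop)
    then have "reduced (h @ drop k p)"
      unfolding append.assoc[symmetric] reduced_append[of "h @ drop k p"] by blast
    moreover have "reduced (take k p @ drop k p @ q)"
      using pr(3) by (metis append_take_drop_id append.assoc)
    then have "reduced (drop k p @ q)"
      unfolding reduced_append[of "take k p"] by blast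
    ultimately have red: "reduced ((h @ drop k p) @ q)"
      using ne unfolding reduced_append by auto
    have "ext x y (w @ [n]) \<approx> reduce (ext x y w) @ img n"
      by (simp add: ext_append ext_Cons freq_def)
    also have "\<dots> = (h @ drop k p) @ r @ finv r @ q"
      by (simp add: h drop pr(2))
    also have "\<dots> \<approx> (h @ drop k p) @ q"
      by (rule freq_mid_finv_right)
    finally have res: "reduce (ext x y (w @ [n])) = (h @ drop k p) @ q"
      using red by (simp add: freq_def)
    have "2 * length r \<le> length (img n)"
      using cancelled_le(2)[OF n(1)] pr(4) by simp
    then have "length r \<le> length q"
      by (simp add: pr(2))
    then have "length (reduce (ext x y w)) \<le> length (reduce (ext x y (w @ [n])))"
      unfolding res h drop by simp
    moreover have "q = drop (cancelled m n) (img n)"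
      using pr(2,4) by simp
    moreover have "\<forall>n'. n' \<noteq> inv_l n \<longrightarrow> cancelled m n + cancelled n n' < length (img n)"
      using cancelled_add_less[OF n(1)] by blast
    ultimately show ?thesis
      using res by (intro exI[of _ "h @ drop k p"] exI[of _ "cancelled m n"]) simp
  qed
qed

lemma length_reduce_ext_mono:
  "reduced (v @ w) \<Longrightarrow> v \<noteq> [] \<Longrightarrow> length (reduce (ext x y v)) \<le> length (reduce (ext x y (v @ w)))"
proof (induction w rule: rev_induct)
  case (snoc n w)
  have "reduced (v @ w)"
    using snoc.prems reduced_append[of "v @ w" "[n]"] by simp
  then have "length (reduce (ext x y v)) \<le> length (reduce (ext x y (v @ w)))"
    using snoc by simp
  also have "\<dots> \<le> length (reduce (ext x y (v @ w @ [n])))"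
    using reduce_ext[of "v @ w @ [n]"] snoc.prems by (auto simp: butlast_append)
  finally show ?case .
qed simp

text \<open>Images of prefixes are no longer than the image of the whole word, here one letter, so
  already the first factor has length one.\<close>

lemma generates_first_letter:
  assumes "generates x y"
  obtains l w where "reduced (l # w)" "ext x y (l # w) \<approx> [c]" "length (img l) = 1"
proof -
  obtain w where w: "ext x y w \<approx> [c]"
    using assms unfolding generates_def by blast
  then have red_w: "ext x y (reduce w) \<approx> [c]"
    using ext_reduce freq_trans by blast
  have "reduce w \<noteq> []"
    using red_w by (auto simp: freq_def reduce_Cons)
  then obtain l v where v: "reduce w = l # v"
    by (cases "reduce w") auto
  have "reduced ([l] @ v)"
    using reduced_reduce[of w] v by simp
  then have "length (reduce (ext x y [l])) \<le> length (reduce (ext x y ([l] @ v)))"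
    by (rule length_reduce_ext_mono) simp
  also have "\<dots> = 1"
    using red_w v by (simp add: freq_def reduce_Cons)
  finally have "length (img l) \<le> 1"
    using reduced_img[of l] by (simp add: ext_def)
  moreover have "length (img l) > 0"
    using img_nonempty by simp
  ultimately have "length (img l) = 1"
    by linarith
  then show ?thesis
    using that[of l v] red_w v \<open>reduced ([l] @ v)\<close> by simp
qed

text \<open>One basis element of length one comes from expressing any letter, the second from
  expressing a letter of the generator that the first one lacks. N1 then excludes equal or inverse
  letters.\<close>

lemma generates_imp_letters:
  assumes "generates x y"
  shows "\<exists>c d. x = [c] \<and> y = [d] \<and> fst c \<noteq> fst d"
proof -
  obtain l1 w1 where l1: "length (img l1) = 1"
    using generates_first_letter[OF assms] by blast
  then obtain c where c: "img l1 = [c]"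
    by (auto simp: length_Suc_conv)
  obtain l2 w2 where l2: "reduced (l2 # w2)" "ext x y (l2 # w2) \<approx> [(other (fst c), False)]"
    "length (img l2) = 1"
    using generates_first_letter[OF assms] by blast
  obtain d where d: "img l2 = [d]"
    using l2(3) by (auto simp: length_Suc_conv)
  have "\<exists>l m c d. fst l \<noteq> fst m \<and> img l = [c] \<and> img m = [d]"
  \<comment> \<open>Equality is contradictory: alone, l2 yields the wrong generator, and a further
    factor cannot cancel against a single letter, so the product would have length at least
    two.\<close>
  proof (cases "fst l1 = fst l2")
    case True
    then have "l2 = l1 \<or> l2 = inv_l l1"
      by (auto simp: inv_l_def prod_eq_iff)
    then have "d = c \<or> d = inv_l c"
      using c d letter_image_inv_l[of x y l1] by auto
    then have fst_d: "fst d = fst c"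
      by (auto simp: inv_l_def)
    show ?thesis
    proof (cases w2)
      case Nil
      then have "[d] \<approx> [(other (fst c), False)]"
        using l2(2) d by (simp add: ext_def)
      then show ?thesis
        using fst_d by (auto simp: freq_def reduce_Cons)
    next
      case (Cons m w3)
      have m: "m \<noteq> inv_l l2"
        using l2(1) Cons by (auto simp: reduced_Cons)
      have "cancelled l2 m = 0"
        using cancelled_le(1)[OF m] l2(3) by simp
      then obtain p q where "img l2 = p" "img m = q" "reduced (p @ q)"
        using cancelledE[of l2 m] by (metis append_Nil append_Nil2 finv_Nil length_0_conv)
      then have "reduce (img l2 @ img m) = img l2 @ img m"
        by simp
      then have "length (img l2 @ img m) = length (reduce (ext x y [l2, m]))"
        by (simp add: ext_def)
      also have "\<dots> \<le> length (reduce (ext x y ([l2, m] @ w3)))"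
        using l2(1) Cons by (intro length_reduce_ext_mono) auto
      also have "\<dots> = 1"
        using l2(2) Cons by (simp add: freq_def reduce_Cons)
      finally show ?thesis
        using l2(3) img_nonempty[of m] by simp
    qed
  next
    case False
    then show ?thesis
      using c d by blast
  qed
  then obtain l m c' d' where lm: "fst l \<noteq> fst m" "img l = [c']" "img m = [d']"
    by blast
  have "\<exists>c d. x = [c] \<and> y = [d]"
  proof -
    have len: "length x = length (img (GA, s))" "length y = length (img (GB, s))" for s
      by simp_all
    have "length x = 1 \<and> length y = 1"
      using lm len[of "snd l"] len[of "snd m"]
      by (cases l; cases m; cases "fst l"; cases "fst m") auto
    then show ?thesis
      by (auto simp: length_Suc_conv)
  qed
  then obtain c d where cd: "x = [c]" "y = [d]"
    by blast
  have "fst c \<noteq> fst d"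
  proof
    assume "fst c = fst d"
    then have "d = c \<or> d = inv_l c"
      by (auto simp: inv_l_def prod_eq_iff)
    then show False
      using N1[of "(GA, True)" "(GB, False)"] N1[of "(GA, False)" "(GB, False)"] cd
      by (auto simp: reduce_Cons)
  qed
  then show ?thesis
    using cd by blast
qed

end

text \<open>All images are products of y and its inverse, hence commute, while a and b do
  not.\<close>

lemma not_generates_Nil: "\<not> generates [] y"
proof
  assume gen: "generates [] y"
  define c where "c l = letter_image [] y l" for l
  have y_comm: "c l @ c m \<approx> c m @ c l" for l m
    by (cases l; cases m; cases "fst l"; cases "fst m")
       (auto simp: c_def intro: freq_trans[OF freq_finv_right freq_sym[OF freq_finv_left]]
          freq_trans[OF freq_finv_left freq_sym[OF freq_finv_right]])
  have letter: "c l @ ext [] y w \<approx> ext [] y w @ c l" for l w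
  proof (induction w)
    case (Cons m w)
    have "(c l @ c m) @ ext [] y w \<approx> (c m @ c l) @ ext [] y w"
      by (intro freq_append y_comm freq_refl)
    also have "\<dots> = c m @ (c l @ ext [] y w)"
      by simp
    also have "\<dots> \<approx> c m @ (ext [] y w @ c l)"
      by (intro freq_append Cons freq_refl)
    finally show ?case
      by (simp add: ext_Cons c_def)
  qed simp
  have comm: "ext [] y v @ ext [] y w \<approx> ext [] y w @ ext [] y v" for v w
  proof (induction v)
    case (Cons m v)
    have "c m @ (ext [] y v @ ext [] y w) \<approx> c m @ (ext [] y w @ ext [] y v)"
      by (intro freq_append Cons freq_refl)
    also have "\<dots> = (c m @ ext [] y w) @ ext [] y v"
      by simp
    also have "\<dots> \<approx> (ext [] y w @ c m) @ ext [] y v"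
      by (intro freq_append letter freq_refl)
    finally show ?case
      by (simp add: ext_Cons c_def)
  qed simp
  obtain v w where v: "ext [] y v \<approx> [(GA, False)]" and w: "ext [] y w \<approx> [(GB, False)]"
    using gen unfolding generates_def by blast
  have "[(GA, False)] @ [(GB, False)] \<approx> ext [] y v @ ext [] y w"
    by (rule freq_append[OF freq_sym[OF v] freq_sym[OF w]])
  also have "\<dots> \<approx> ext [] y w @ ext [] y v"
    by (rule comm)
  also have "\<dots> \<approx> [(GB, False)] @ [(GA, False)]"
    by (rule freq_append[OF w v])
  finally show False
    by (simp add: freq_def reduce_Cons inv_l_def)
qed

lemma settles_Nil: "settles [] y" "settles x []"
proof -
  show "settles [] y" for y
    using not_generates_Nil by (simp add: settles_def)
  then show "settles x []"
    by (rule settles_swap)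
qed

text \<open>Nielsen reduction by total length: a violation of N1 or N2 gives a change that shortens
  the pair. A Nielsen reduced generating pair is a signed permutation of the basis, where the
  trivial test map decides.\<close>

lemma settles_reduced: "reduced x \<Longrightarrow> reduced y \<Longrightarrow> settles x y"
proof (induction "length x + length y" arbitrary: x y rule: less_induct)
  case less
  have IH: "settles x' y'" if "length (reduce x') + length (reduce y') < length x + length y" for x' y'
    using settles_freq[OF less.hyps[OF that] freq_sym[OF freq_reduce] freq_sym[OF freq_reduce]] by simp
  have len: "length (letter_image x y l) + length (letter_image x y m) = length x + length y"
    if "fst l \<noteq> fst m" for l m
    using that by (cases l; cases m; cases "fst l"; cases "fst m") auto
  have red: "reduced (letter_image x y l)" for l
    using less.prems by (cases "(x, y, l)" rule: letter_image.cases) auto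
  show ?case
  proof (cases "x = [] \<or> y = []")
    case True
    then show ?thesis
      using settles_Nil by auto
  next
    case nonempty: False
    show ?thesis
    proof (cases "nielsen_reduced x y")
      case True
      then interpret nielsen_reduced x y .
      show ?thesis
        unfolding settles_def
      proof (intro impI allI)
        fix u v
        assume gen: "generates x y" and uv: "nequiv u v"
        obtain c d where cd: "x = [c]" "y = [d]" "fst c \<noteq> fst d"
          using generates_imp_letters[OF gen] by blast
        have "clen (flip_nielsens False [] u) = clen (flip_nielsens False [] v)"
          using uv unfolding nequiv_def by blast
        then show "clen (ext x y u) = clen (ext x y v)"
          by (simp add: cd clen_letters flip_nielsens_def)
      qed
    next
      case False
      then consider (N1) l m where "fst l \<noteq> fst m" "length (reduce (letter_image x y l @ letter_image x y m)) < length (letter_image x y l)"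
        | (N2) l m p q z where "fst l \<noteq> fst m" "letter_image x y m = p @ q" "length p = length q" "letter_image x y l = finv q @ z @ finv p"
        using less.prems nonempty unfolding nielsen_reduced_def by (auto simp: not_le)
      then show ?thesis
      proof cases
        case (N1 l m)
        show ?thesis
        proof (rule settles_letter_image[of _ _ l m], rule settles_mult_right, rule IH)
          show "length (reduce (letter_image x y l @ letter_image x y m)) + length (reduce (letter_image x y m))
              < length x + length y"
            using N1(2) len[OF N1(1)] red[of m] by simp
        qed (rule N1(1))
      next
        case (N2 l m p q z)
        txt \<open>Conjugation by q turns (q^-1 z p^-1, p q) into (z p^-1 q^-1, q p), and multiplication
          by q p shortens this pair to (z, q p).\<close>
        have "letter_image x y m \<noteq> []"
          using nonempty by (cases "(x, y, m)" rule: letter_image.cases) auto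
        then have "p \<noteq> []"
          using N2(2,3) by auto
        have "settles (z @ finv p @ finv q) (q @ p)"
        proof (rule settles_mult_right, rule IH)
          have eq: "reduce ((z @ finv p @ finv q) @ q @ p) = reduce z"
            using freq_mid_finv_left[of "z @ finv p" q p] freq_mid_finv_left[of z p "[]"]
            by (simp add: freq_def)
          have "length (reduce z) + length (reduce (q @ p)) \<le> length z + (length q + length p)"
            using add_mono[OF length_reduce[of z] length_reduce[of "q @ p"]] by simp
          moreover have "length x + length y = length z + (length q + length p) + (length p + length q)"
            using len[OF N2(1)] N2(2,4) by simp
          moreover have "length p > 0"
            using \<open>p \<noteq> []\<close> by simp
          ultimately show "length (reduce ((z @ finv p @ finv q) @ q @ p)) + length (reduce (q @ p)) < length x + length y"
            unfolding eq by linarith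
        qed
        then have "settles (letter_image x y l) (letter_image x y m)"
        proof (rule settles_conjugate[of _ _ _ "finv q"])
          show "letter_image x y l \<approx> finv q @ (z @ finv p @ finv q) @ finv (finv q)"
            using freq_mid_finv_left[of "finv q @ z @ finv p" q "[]"] by (simp add: N2(4) freq_sym)
          show "letter_image x y m \<approx> finv q @ (q @ p) @ finv (finv q)"
            using freq_mid_finv_left[of "[]" q "p @ q"] by (simp add: N2(2) freq_sym)
        qed
        then show ?thesis
          using N2(1) by (rule settles_letter_image)
      qed
    qed
  qed
qed

lemma settles: "settles x y"
  using settles_freq[OF settles_reduced freq_sym[OF freq_reduce] freq_sym[OF freq_reduce]] by simp

section \<open>Automorphisms through the images of the generators\<close>

lemma is_aut_F2: "is_aut \<phi> \<Longrightarrow> w \<in> F2 \<Longrightarrow> \<phi> w \<in> F2"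
  unfolding is_aut_def by (meson bij_betwE)

lemma is_aut_mult:
  assumes "is_aut \<phi>" "u \<in> F2" "v \<in> F2"
  shows "\<phi> (reduce (u @ v)) \<approx> \<phi> u @ \<phi> v"
  using assms by (simp add: is_aut_def fmult_def)

lemma is_aut_Nil:
  assumes "is_aut \<phi>"
  shows "\<phi> [] = []"
proof -
  have red: "[] \<in> F2" "reduced (\<phi> [])"
    using is_aut_F2[OF assms, of "[]"] by (simp_all add: F2_def)
  have "\<phi> [] \<approx> \<phi> [] @ \<phi> []"
    using is_aut_mult[OF assms red(1) red(1)] by simp
  then have "finv (\<phi> []) @ \<phi> [] \<approx> finv (\<phi> []) @ \<phi> [] @ \<phi> []"
    by (rule freq_append[OF freq_refl])
  then have "[] \<approx> \<phi> []"
    using freq_finv_left[of "\<phi> []"] freq_mid_finv_left[of "[]" "\<phi> []" "\<phi> []"]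
    by (simp add: freq_def)
  then show ?thesis
    using red(2) by (simp add: freq_def)
qed

lemma is_aut_inv_l:
  assumes "is_aut \<phi>"
  shows "\<phi> [inv_l l] \<approx> finv (\<phi> [l])"
proof -
  have F2: "[m] \<in> F2" for m
    by (simp add: F2_def reduced_Cons)
  have "\<phi> [inv_l l] @ \<phi> [l] \<approx> \<phi> (reduce ([inv_l l] @ [l]))"
    by (rule freq_sym[OF is_aut_mult[OF assms F2 F2]])
  also have "reduce ([inv_l l] @ [l]) = []"
    by (simp add: reduce_Cons)
  finally show ?thesis
    using freq_move_right[of "\<phi> [inv_l l]" "\<phi> [l]" "[]"] is_aut_Nil[OF assms] by simp
qed

lemma is_aut_eq_ext:
  assumes "is_aut \<phi>" "w \<in> F2"
  shows "\<phi> w \<approx> ext (\<phi> [(GA, False)]) (\<phi> [(GB, False)]) w"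
  using assms(2)
proof (induction w)
  case Nil
  then show ?case
    by (simp add: is_aut_Nil[OF assms(1)])
next
  case (Cons l w)
  let ?x = "\<phi> [(GA, False)]" and ?y = "\<phi> [(GB, False)]"
  have "[l] \<in> F2" "w \<in> F2" "reduce ([l] @ w) = l # w"
    using Cons.prems by (auto simp: F2_def reduced_Cons)
  then have "\<phi> (l # w) \<approx> \<phi> [l] @ \<phi> w"
    using is_aut_mult[OF assms(1), of "[l]" w] by simp
  also have "\<dots> \<approx> letter_image ?x ?y l @ ext ?x ?y w"
  proof (rule freq_append)
    show "\<phi> [l] \<approx> letter_image ?x ?y l"
      using is_aut_inv_l[OF assms(1), of "(fst l, False)"]
      by (cases "(?x, ?y, l)" rule: letter_image.cases) (auto simp: inv_l_def)
    show "\<phi> w \<approx> ext ?x ?y w"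
      by (rule Cons.IH) fact
  qed
  finally show ?case
    by (simp add: ext_Cons)
qed

lemma nequiv_imp_translation_equivalent:
  assumes "u \<in> F2" "v \<in> F2" "nequiv u v"
  shows "translation_equivalent u v"
  unfolding translation_equivalent_def
proof (intro allI impI)
  fix \<phi> assume aut: "is_aut \<phi>"
  let ?x = "\<phi> [(GA, False)]" and ?y = "\<phi> [(GB, False)]"
  have "generates ?x ?y"
    unfolding generates_def
  proof
    fix z
    have "reduce z \<in> \<phi> ` F2"
      using aut by (auto simp: is_aut_def bij_betw_def F2_def)
    then obtain w where "w \<in> F2" "\<phi> w = reduce z"
      by auto
    then have "ext ?x ?y w \<approx> z"
      using is_aut_eq_ext[OF aut \<open>w \<in> F2\<close>] by (simp add: freq_def)
    then show "\<exists>w. ext ?x ?y w \<approx> z" ..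
  qed
  then have "clen (ext ?x ?y u) = clen (ext ?x ?y v)"
    using settles[of ?x ?y] assms(3) unfolding settles_def by blast
  moreover have "cyc_len (\<phi> w) = clen (ext ?x ?y w)" if "w \<in> F2" for w
    using clen_freq[OF is_aut_eq_ext[OF aut that]] clen_F2[OF is_aut_F2[OF aut that]] by simp
  ultimately show "cyc_len (\<phi> u) = cyc_len (\<phi> v)"
    using assms by simp
qed

section \<open>Test automorphisms encoded by lists of numbers\<close>

lemma is_aut_ext:
  assumes "\<And>w. ext x y (ext x' y' w) \<approx> w" "\<And>w. ext x' y' (ext x y w) \<approx> w"
  shows "is_aut (\<lambda>w. reduce (ext x y w))"
  unfolding is_aut_def
proof (intro conjI ballI)
  have inverse: "reduce (ext a b (reduce (ext a' b' w))) = w"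
    if "w \<in> F2" "\<And>w. ext a b (ext a' b' w) \<approx> w" for a b a' b' w
    using freq_trans[OF ext_reduce[of a b "ext a' b' w"] that(2)] that(1)
    by (simp add: freq_def F2_def)
  show "bij_betw (\<lambda>w. reduce (ext x y w)) F2 F2"
    by (rule bij_betw_byWitness[where f' = "\<lambda>w. reduce (ext x' y' w)"])
       (auto simp: inverse assms F2_def)
next
  fix u v
  show "reduce (ext x y (fmult u v)) = fmult (reduce (ext x y u)) (reduce (ext x y v))"
    using ext_reduce[of x y "u @ v"] by (simp add: fmult_def ext_append freq_def)
qed

lemma is_aut_comp:
  assumes "is_aut \<phi>" "is_aut \<psi>"
  shows "is_aut (\<lambda>w. \<phi> (\<psi> w))"
  unfolding is_aut_def
proof (intro conjI ballI)
  show "bij_betw (\<lambda>w. \<phi> (\<psi> w)) F2 F2"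
    using bij_betw_trans[of \<psi> F2 F2 \<phi> F2] assms by (simp add: is_aut_def comp_def)
  fix u v assume "u \<in> F2" "v \<in> F2"
  then show "\<phi> (\<psi> (fmult u v)) = fmult (\<phi> (\<psi> u)) (\<phi> (\<psi> v))"
    using assms is_aut_F2[OF assms(2)] by (simp add: is_aut_def)
qed

definition move :: "nat \<Rightarrow> letter list \<Rightarrow> letter list" where
  "move h w = reduce (if h = 0 then fl w else if h = 1 then sg w else tu w)"

lemma is_aut_move: "is_aut (move h)"
proof -
  have "is_aut (\<lambda>w. reduce (fl w))"
    by (rule is_aut_ext[of _ _ "[(GA, False)]" "[(GB, True)]"])
       (simp_all add: ext_ext ext_Cons inv_l_def ext_id)
  moreover have eq: "ext x y w \<approx> w" if "x \<approx> [(GA, False)]" "y \<approx> [(GB, False)]" for x y w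
    using ext_cong_freq[OF that] by (simp add: ext_id)
  have "is_aut (\<lambda>w. reduce (sg w))"
    by (rule is_aut_ext[of _ _ "[(GA, False), (GB, True)]" "[(GB, False)]"]; unfold ext_ext; rule eq)
       (simp_all add: ext_Cons inv_l_def freq_def reduce_Cons)
  moreover have "is_aut (\<lambda>w. reduce (tu w))"
    by (rule is_aut_ext[of _ _ "[(GA, False)]" "[(GB, False), (GA, True)]"]; unfold ext_ext; rule eq)
       (simp_all add: ext_Cons inv_l_def freq_def reduce_Cons)
  ultimately show ?thesis
    by (cases "h = 0"; cases "h = 1") (simp_all add: move_def[abs_def])
qed

definition moves :: "nat list \<Rightarrow> letter list \<Rightarrow> letter list" where
  "moves c w = foldl (\<lambda>x h. move h x) w c"

lemma moves_simps [simp]: "moves [] w = w" "moves (h # c) w = moves c (move h w)"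
  by (simp_all add: moves_def)

lemma reduced_move [simp]: "reduced (move h w)"
  by (simp add: move_def)

lemma reduced_moves: "reduced w \<Longrightarrow> reduced (moves c w)"
  by (induction c arbitrary: w) auto

lemma is_aut_moves: "is_aut (moves c)"
proof (induction c)
  case Nil
  then show ?case
    using bij_betw_id[of F2] by (simp add: is_aut_def id_def)
next
  case (Cons h c)
  then show ?case
    using is_aut_comp[OF Cons is_aut_move[of h]] by simp
qed

lemma translation_equivalent_imp_moves:
  assumes "u \<in> F2" "v \<in> F2" "translation_equivalent u v"
  shows "clen (moves c u) = clen (moves c v)"
  using assms(3) is_aut_moves[of c] clen_F2[OF is_aut_F2[OF is_aut_moves[of c]]] assms(1,2)
  by (simp add: translation_equivalent_def)

lemma moves_nielsens: "w \<approx> w' \<Longrightarrow> moves (map (\<lambda>s. if s then 1 else 2) P) w \<approx> nielsens P w'"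
proof (induction P arbitrary: w w')
  case (Cons s P)
  have "move (if s then 1 else 2) w \<approx> nielsen s w'"
    using ext_freq[OF Cons.prems] by (simp add: move_def freq_def)
  then show ?case
    using Cons.IH by simp
qed simp

text \<open>The bound exceeds that of \<open>clen_nielsens_eqI\<close> by one for the initial
  \<open>fl\<close>, which does not change word lengths.\<close>

lemma moves_imp_translation_equivalent:
  assumes "u \<in> F2" "v \<in> F2"
    and moves: "\<And>c. length c \<le> 4 * length u + 4 * length v + 2 \<Longrightarrow> set c \<subseteq> {..2} \<Longrightarrow>
      clen (moves c u) = clen (moves c v)"
  shows "translation_equivalent u v"
proof (rule nequiv_imp_translation_equivalent[OF assms(1,2)])
  have len: "length (fl w) = length w" for w
  proof (induction w)
    case (Cons l w)
    have "length (letter_image [(GA, False)] [(GB, True)] l) = 1"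
      by (cases l; cases "fst l") auto
    then show ?case
      using Cons by (simp add: ext_Cons)
  qed simp
  have "clen (nielsens P (if d then fl u else u)) = clen (nielsens P (if d then fl v else v))" for d P
  proof (rule clen_nielsens_eqI)
    fix P :: "bool list"
    assume "length P \<le> 4 * length (if d then fl u else u) + 4 * length (if d then fl v else v) + 1"
    then have P: "length P \<le> 4 * length u + 4 * length v + 1"
      by (auto simp: len split: if_splits)
    define c where "c = (if d then [0] else []) @ map (\<lambda>s. if s then 1 else 2 :: nat) P"
    have eq: "moves c w \<approx> nielsens P (if d then fl w else w)" for w
      using moves_nielsens[of "move 0 w" "fl w" P] moves_nielsens[of w w P]
      by (simp add: c_def move_def freq_def)
    have "clen (moves c u) = clen (moves c v)"
      using P by (intro moves) (auto simp: c_def)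
    then show "clen (nielsens P (if d then fl u else u)) = clen (nielsens P (if d then fl v else v))"
      using clen_freq[OF eq[of u]] clen_freq[OF eq[of v]] by simp
  qed
  then show "nequiv u v"
    by (simp add: nequiv_def flip_nielsens_def)
qed

section \<open>Computable functions\<close>

definition computable :: "nat \<Rightarrow> (nat list \<Rightarrow> nat) \<Rightarrow> bool" where
  "computable n f \<longleftrightarrow> (\<exists>p. \<forall>xs. length xs = n \<longrightarrow> rec_eval p xs (f xs))"

definition computable1 :: "(nat \<Rightarrow> nat) \<Rightarrow> bool" where
  "computable1 f \<longleftrightarrow> computable 1 (\<lambda>xs. f (xs ! 0))"

definition computable2 :: "(nat \<Rightarrow> nat \<Rightarrow> nat) \<Rightarrow> bool" where
  "computable2 f \<longleftrightarrow> computable 2 (\<lambda>xs. f (xs ! 0) (xs ! 1))"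

definition computable3 :: "(nat \<Rightarrow> nat \<Rightarrow> nat \<Rightarrow> nat) \<Rightarrow> bool" where
  "computable3 f \<longleftrightarrow> computable 3 (\<lambda>xs. f (xs ! 0) (xs ! 1) (xs ! 2))"

definition computable4 :: "(nat \<Rightarrow> nat \<Rightarrow> nat \<Rightarrow> nat \<Rightarrow> nat) \<Rightarrow> bool" where
  "computable4 f \<longleftrightarrow> computable 4 (\<lambda>xs. f (xs ! 0) (xs ! 1) (xs ! 2) (xs ! 3))"

lemmas computable_defs = computable1_def computable2_def computable3_def computable4_def

lemma computable_cong:
  "computable n f \<Longrightarrow> (\<And>xs. length xs = n \<Longrightarrow> f xs = g xs) \<Longrightarrow> computable n g"
  unfolding computable_def by fastforce

lemma computable_nth: "i < n \<Longrightarrow> computable n (\<lambda>xs. xs ! i)"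
  unfolding computable_def by (metis proj)

lemma computable_comp:
  assumes "computable (length es) f" "\<And>e. e \<in> set es \<Longrightarrow> computable n e"
  shows "computable n (\<lambda>xs. f (map (\<lambda>e. e xs) es))"
proof -
  obtain p where p: "\<And>ys. length ys = length es \<Longrightarrow> rec_eval p ys (f ys)"
    using assms(1) unfolding computable_def by blast
  obtain q where q: "\<And>e xs. e \<in> set es \<Longrightarrow> length xs = n \<Longrightarrow> rec_eval (q e) xs (e xs)"
    using assms(2) unfolding computable_def by metis
  have "rec_eval (Comp p (map q es)) xs (f (map (\<lambda>e. e xs) es))" if "length xs = n" for xs
    using p[of "map (\<lambda>e. e xs) es"] q[OF _ that]
    by (intro comp[of xs _ "map (\<lambda>e. e xs) es"]) (auto simp: list_all2_conv_all_nth)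
  then show ?thesis
    unfolding computable_def by blast
qed

lemma computable_comp1:
  assumes "computable1 f" "computable n e"
  shows "computable n (\<lambda>xs. f (e xs))"
  using computable_comp[of "[e]" "\<lambda>xs. f (xs ! 0)" n] assms by (simp add: computable_defs)

lemma computable_comp2:
  assumes "computable2 f" "computable n e1" "computable n e2"
  shows "computable n (\<lambda>xs. f (e1 xs) (e2 xs))"
proof -
  have f: "computable (length [e1, e2]) (\<lambda>xs. f (xs ! 0) (xs ! 1))"
    using assms(1) by (simp add: computable2_def numeral_2_eq_2)
  have "e = e1 \<or> e = e2 \<Longrightarrow> computable n e" for e
    using assms(2,3) by blast
  then show ?thesis
    using computable_comp[OF f, of n] by simp
qed

lemma computable_comp3:
  assumes "computable3 f" "computable n e1" "computable n e2" "computable n e3"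
  shows "computable n (\<lambda>xs. f (e1 xs) (e2 xs) (e3 xs))"
proof -
  have f: "computable (length [e1, e2, e3]) (\<lambda>xs. f (xs ! 0) (xs ! 1) (xs ! 2))"
    using assms(1) by (simp add: computable3_def numeral_3_eq_3)
  have "e = e1 \<or> e = e2 \<or> e = e3 \<Longrightarrow> computable n e" for e
    using assms(2-4) by blast
  then show ?thesis
    using computable_comp[OF f, of n] by simp
qed

lemma computable_Suc: "computable n e \<Longrightarrow> computable n (\<lambda>xs. Suc (e xs))"
proof -
  have "rec_eval Succ xs (Suc (xs ! 0))" if "length xs = 1" for xs
    using that succ[of "xs ! 0" "[]"] by (cases xs) auto
  then have "computable1 Suc"
    unfolding computable_def computable1_def by blast
  then show "computable n e \<Longrightarrow> computable n (\<lambda>xs. Suc (e xs))"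
    by (rule computable_comp1)
qed

lemma computable_const: "computable n (\<lambda>_. c)"
proof (induction c)
  case 0
  then show ?case
    unfolding computable_def using zero by blast
qed (rule computable_Suc)

lemma computable_rec_nat:
  assumes "computable n f" "computable (Suc (Suc n)) g"
  shows "computable (Suc n) (\<lambda>xs. rec_nat (f (tl xs)) (\<lambda>k r. g (k # r # tl xs)) (hd xs))"
proof -
  obtain p q where p: "\<And>ys. length ys = n \<Longrightarrow> rec_eval p ys (f ys)"
    and q: "\<And>ys. length ys = Suc (Suc n) \<Longrightarrow> rec_eval q ys (g ys)"
    using assms unfolding computable_def by blast
  have "rec_eval (Prec p q) (m # ys) (rec_nat (f ys) (\<lambda>k r. g (k # r # ys)) m)"
    if "length ys = n" for m ys
  proof (induction m)
    case (Suc m)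
    then show ?case
      using q[of "m # rec_nat (f ys) (\<lambda>k r. g (k # r # ys)) m # ys"] that by (auto intro: precS)
  qed (use p that in \<open>auto intro: prec0\<close>)
  then have "rec_eval (Prec p q) xs (rec_nat (f (tl xs)) (\<lambda>k r. g (k # r # tl xs)) (hd xs))"
    if "length xs = Suc n" for xs
    using that by (cases xs) auto
  then show ?thesis
    unfolding computable_def by blast
qed

lemma computable_rec_nat_0:
  assumes "computable2 g"
  shows "computable1 (rec_nat c g)"
proof -
  have "computable (Suc 0) (\<lambda>xs. rec_nat c
      (\<lambda>k r. (\<lambda>ys. g (ys ! 0) (ys ! 1)) (k # r # tl xs)) (hd xs))"
    using assms by (intro computable_rec_nat computable_const) (simp add: computable_defs numeral_2_eq_2)
  then show ?thesis
    unfolding computable1_def One_nat_def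
    by (rule computable_cong) (auto simp: length_Suc_conv)
qed

lemma computable_rec_nat_1:
  assumes "computable1 f" "computable3 g"
  shows "computable2 (\<lambda>m x. rec_nat (f x) (\<lambda>k r. g k r x) m)"
proof -
  have "computable (Suc 1) (\<lambda>xs. rec_nat ((\<lambda>ys. f (ys ! 0)) (tl xs))
      (\<lambda>k r. (\<lambda>ys. g (ys ! 0) (ys ! 1) (ys ! 2)) (k # r # tl xs)) (hd xs))"
    using assms by (intro computable_rec_nat) (simp_all add: computable_defs numeral_3_eq_3)
  then have "computable 2 (\<lambda>xs. rec_nat ((\<lambda>ys. f (ys ! 0)) (tl xs))
      (\<lambda>k r. (\<lambda>ys. g (ys ! 0) (ys ! 1) (ys ! 2)) (k # r # tl xs)) (hd xs))"
    by (simp only: Suc_1)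
  then show ?thesis
    unfolding computable2_def
    by (rule computable_cong) (auto simp: length_Suc_conv numeral_2_eq_2)
qed

lemma computable_rec_nat_2:
  assumes "computable2 f" "computable4 g"
  shows "computable3 (\<lambda>m x y. rec_nat (f x y) (\<lambda>k r. g k r x y) m)"
proof -
  have four: "Suc (Suc 2) = 4" and three: "Suc 2 = 3"
    by simp_all
  have "computable (Suc 2) (\<lambda>xs. rec_nat ((\<lambda>ys. f (ys ! 0) (ys ! 1)) (tl xs))
      (\<lambda>k r. (\<lambda>ys. g (ys ! 0) (ys ! 1) (ys ! 2) (ys ! 3)) (k # r # tl xs)) (hd xs))"
    using assms by (intro computable_rec_nat) (simp_all only: computable_defs four)
  then show ?thesis
    unfolding computable3_def three
    by (rule computable_cong) (auto simp: length_Suc_conv numeral_2_eq_2 numeral_3_eq_3)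
qed

section \<open>Arithmetic and Cantor pairing\<close>

named_theorems comput
declare computable_const [comput] computable_nth [comput] computable_Suc [comput]
declare computable_defs [THEN iffD2, comput]

lemma computable_add [comput]:
  "computable n e1 \<Longrightarrow> computable n e2 \<Longrightarrow> computable n (\<lambda>xs. e1 xs + e2 xs)"
proof -
  have "computable2 (\<lambda>m x. rec_nat x (\<lambda>k r. Suc r) m)"
    by (rule computable_rec_nat_1) (rule comput | simp; fail)+
  moreover have "rec_nat x (\<lambda>k r. Suc r) m = m + x" for m x
    by (induction m) auto
  ultimately have "computable2 (\<lambda>m x. m + x)"
    by simp
  then show "computable n e1 \<Longrightarrow> computable n e2 \<Longrightarrow> computable n (\<lambda>xs. e1 xs + e2 xs)"
    by (rule computable_comp2)
qed

lemma computable_diff [comput]: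
  "computable n e1 \<Longrightarrow> computable n e2 \<Longrightarrow> computable n (\<lambda>xs. e1 xs - e2 xs)"
proof -
  have pred_eq: "rec_nat 0 (\<lambda>k r. k) = (\<lambda>m. m - 1)"
  proof
    show "rec_nat 0 (\<lambda>k r. k) m = m - 1" for m
      by (cases m) auto
  qed
  have "computable1 (rec_nat 0 (\<lambda>k r. k))"
    by (rule computable_rec_nat_0) (rule comput | simp; fail)+
  then have pred: "computable1 (\<lambda>m. m - 1)"
    unfolding pred_eq .
  have "computable2 (\<lambda>m x. rec_nat x (\<lambda>k r. r - 1) m)"
    by (rule computable_rec_nat_1) (rule comput computable_comp1[OF pred] | simp; fail)+
  moreover have "rec_nat x (\<lambda>k r. r - 1) m = x - m" for m x
    by (induction m) auto
  ultimately have *: "computable2 (\<lambda>m x. x - m)"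
    by simp
  show "computable n e1 \<Longrightarrow> computable n e2 \<Longrightarrow> computable n (\<lambda>xs. e1 xs - e2 xs)"
    using computable_comp2[OF *, of n e2 e1] by simp
qed

lemma computable_if_0:
  assumes "computable n c" "computable n e1" "computable n e2"
  shows "computable n (\<lambda>xs. if c xs = 0 then e1 xs else e2 xs)"
proof -
  have "computable3 (\<lambda>m x y. rec_nat x (\<lambda>k r. y) m)"
    by (rule computable_rec_nat_2) (rule comput | simp; fail)+
  moreover have "rec_nat x (\<lambda>k r. y) m = (if m = 0 then x else y)" for m x y :: nat
    by (cases m) auto
  ultimately have "computable3 (\<lambda>m x y. if m = 0 then x else y)"
    by simp
  then show ?thesis
    using assms by (rule computable_comp3)
qed

lemma computable_if_le [comput]:
  assumes "computable n a" "computable n b" "computable n e1" "computable n e2"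
  shows "computable n (\<lambda>xs. if a xs \<le> b xs then e1 xs else e2 xs)"
  using computable_if_0[OF computable_diff[OF assms(1,2)] assms(3,4)] by simp

lemma computable_if_eq [comput]:
  assumes "computable n a" "computable n b" "computable n e1" "computable n e2"
  shows "computable n (\<lambda>xs. if a xs = b xs then e1 xs else e2 xs)"
proof (rule computable_cong)
  show "computable n (\<lambda>xs. if (a xs - b xs) + (b xs - a xs) = 0 then e1 xs else e2 xs)"
    by (intro computable_if_0 computable_add computable_diff assms)
qed auto

lemma computable_triangle [comput]: "computable n e \<Longrightarrow> computable n (\<lambda>xs. triangle (e xs))"
proof -
  have "computable1 (rec_nat 0 (\<lambda>k r. r + Suc k))"
    by (rule computable_rec_nat_0) (rule comput | simp; fail)+
  moreover have "rec_nat 0 (\<lambda>k r. r + Suc k) m = triangle m" for m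
    by (induction m) auto
  then have "rec_nat 0 (\<lambda>k r. r + Suc k) = triangle"
    by blast
  ultimately have "computable1 triangle"
    by simp
  then show "computable n e \<Longrightarrow> computable n (\<lambda>xs. triangle (e xs))"
    by (rule computable_comp1)
qed

lemma computable_prod_encode [comput]:
  "computable n e1 \<Longrightarrow> computable n e2 \<Longrightarrow> computable n (\<lambda>xs. prod_encode (e1 xs, e2 xs))"
  unfolding prod_encode_def prod.case by (intro comput)

text \<open>The index of the diagonal of x in Cantor's enumeration, by primitive recursion: as x
  grows by one, it grows by at most one. Through it \<open>prod_decode\<close> becomes
  explicit.\<close>

definition triangle_root :: "nat \<Rightarrow> nat" where
  "triangle_root = rec_nat 0 (\<lambda>k r. if triangle (Suc r) \<le> Suc k then Suc r else r)"

lemma triangle_root_le: "triangle (triangle_root x) \<le> x \<and> x < triangle (Suc (triangle_root x))"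
  by (induction x) (auto simp: triangle_root_def)

lemma triangle_mono: "m \<le> n \<Longrightarrow> triangle m \<le> triangle n"
  by (induction n) (auto simp: le_Suc_eq)

lemma triangle_root_add:
  assumes "m \<le> s"
  shows "triangle_root (triangle s + m) = s"
proof -
  let ?r = "triangle_root (triangle s + m)"
  have "\<not> ?r < s"
    using triangle_root_le[of "triangle s + m"] triangle_mono[of "Suc ?r" s] by linarith
  moreover have "\<not> s < ?r"
    using triangle_root_le[of "triangle s + m"] triangle_mono[of "Suc s" ?r] triangle_Suc[of s] assms
    by linarith
  ultimately show ?thesis
    by linarith
qed

lemma prod_decode_eq:
  "fst (prod_decode x) = x - triangle (triangle_root x)"
  "snd (prod_decode x) = triangle_root x - (x - triangle (triangle_root x))"
proof -
  obtain m n where mn: "prod_decode x = (m, n)"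
    by fastforce
  then have "x = prod_encode (m, n)"
    by (metis prod_decode_inverse)
  then have x: "x = triangle (m + n) + m"
    by (simp add: prod_encode_def)
  then have "triangle_root x = m + n"
    using triangle_root_add by simp
  then show "fst (prod_decode x) = x - triangle (triangle_root x)"
    "snd (prod_decode x) = triangle_root x - (x - triangle (triangle_root x))"
    using mn x by simp_all
qed

lemma computable_triangle_root [comput]:
  "computable n e \<Longrightarrow> computable n (\<lambda>xs. triangle_root (e xs))"
proof -
  have "computable1 triangle_root"
    unfolding triangle_root_def by (rule computable_rec_nat_0) (rule comput | simp; fail)+
  then show "computable n e \<Longrightarrow> computable n (\<lambda>xs. triangle_root (e xs))"
    by (rule computable_comp1)
qed

section \<open>Folds over encoded lists\<close>

definition code_hd :: "nat \<Rightarrow> nat" where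
  "code_hd x = fst (prod_decode (x - 1))"

definition code_tl :: "nat \<Rightarrow> nat" where
  "code_tl x = snd (prod_decode (x - 1))"

lemma computable_code_hd [comput]: "computable n e \<Longrightarrow> computable n (\<lambda>xs. code_hd (e xs))"
  unfolding code_hd_def prod_decode_eq by (intro comput)

lemma computable_code_tl [comput]: "computable n e \<Longrightarrow> computable n (\<lambda>xs. code_tl (e xs))"
  unfolding code_tl_def prod_decode_eq by (intro comput)

lemma code_hd_Cons [simp]: "code_hd (list_encode (x # xs)) = x"
  by (simp add: code_hd_def)

text \<open>Also covers the empty list, whose code 0 is its own tail; iterated tails thus stay empty
  past the end.\<close>

lemma code_tl_list_encode [simp]: "code_tl (list_encode xs) = list_encode (tl xs)"
proof (cases xs)
  case Nil
  have "prod_decode 0 = (0, 0)"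
    by (simp add: prod_decode_def prod_decode_aux.simps)
  then show ?thesis
    using Nil by (simp add: code_tl_def)
qed (simp add: code_tl_def)

lemma list_encode_eq_0_iff [simp]: "list_encode xs = 0 \<longleftrightarrow> xs = []"
  by (cases xs) auto

lemma length_le_list_encode: "length xs \<le> list_encode xs"
proof (induction xs)
  case (Cons x xs)
  then show ?case
    using le_prod_encode_2[of "list_encode xs" x] by (auto intro: le_trans)
qed simp

text \<open>Recursion on a step counter instead of the list: \<open>rest k x\<close> is the code of
  what remains after k steps, and \<open>acc\<close> idles once it is 0. Running x steps suffices,
  as a list is no longer than its code.\<close>

lemma computable_foldl:
  assumes "computable2 F"
  shows "computable n e1 \<Longrightarrow> computable n e2 \<Longrightarrow> computable n (\<lambda>xs. foldl F (e1 xs) (list_decode (e2 xs)))"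
proof -
  define rest where "rest m x = rec_nat x (\<lambda>k r. code_tl r) m" for m x
  define acc where "acc m a x = rec_nat a (\<lambda>k r. if rest k x = 0 then r else F r (code_hd (rest k x))) m"
    for m a x
  have rest: "computable2 rest"
    unfolding rest_def by (rule computable_rec_nat_1) (rule comput | simp; fail)+
  have "computable3 acc"
    unfolding acc_def
    by (rule computable_rec_nat_2)
       (rule comput computable_comp2[OF assms] computable_comp2[OF rest] | simp; fail)+
  then have "computable2 (\<lambda>a x. acc x a x)"
    unfolding computable2_def by (rule computable_comp3) (rule comput | simp; fail)+
  moreover have "acc x a x = foldl F a (list_decode x)" for a x
  proof -
    have rest_eq: "rest m x = list_encode (drop m (list_decode x))" for m
      by (induction m) (auto simp: rest_def drop_Suc tl_drop simp del: list_encode.simps)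
    have "acc m a x = foldl F a (take m (list_decode x))" for m
    proof (induction m)
      case (Suc m)
      have step: "acc (Suc m) a x =
          (if rest m x = 0 then acc m a x else F (acc m a x) (code_hd (rest m x)))"
        by (simp add: acc_def)
      show ?case
      proof (cases "m < length (list_decode x)")
        case True
        then have "drop m (list_decode x) = list_decode x ! m # drop (Suc m) (list_decode x)"
          by (rule Cons_nth_drop_Suc[symmetric])
        then have "rest m x \<noteq> 0" "code_hd (rest m x) = list_decode x ! m"
          using rest_eq[of m] by (simp_all del: list_encode.simps)
        then show ?thesis
          using Suc True by (simp add: step take_Suc_conv_app_nth)
      next
        case False
        then show ?thesis
          using Suc by (simp add: step rest_eq)
      qed
    qed (simp add: acc_def)
    then show ?thesis
      using length_le_list_encode[of "list_decode x"] by simp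
  qed
  ultimately have "computable2 (\<lambda>a x. foldl F a (list_decode x))"
    by simp
  then show "computable n e1 \<Longrightarrow> computable n e2 \<Longrightarrow> computable n (\<lambda>xs. foldl F (e1 xs) (list_decode (e2 xs)))"
    by (rule computable_comp2)
qed

lemma computable_rev:
  "computable n e \<Longrightarrow> computable n (\<lambda>xs. list_encode (rev (list_decode (e xs))))"
proof -
  assume e: "computable n e"
  have "computable2 (\<lambda>r h. Suc (prod_encode (h, r)))"
    by (rule comput | simp; fail)+
  then have "computable n (\<lambda>xs. foldl (\<lambda>r h. Suc (prod_encode (h, r))) 0 (list_decode (e xs)))"
    by (rule computable_foldl) (rule comput e)+
  moreover have "foldl (\<lambda>r h. Suc (prod_encode (h, r))) (list_encode ys) zs = list_encode (rev zs @ ys)" for ys zs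
    by (induction zs arbitrary: ys) (simp_all flip: list_encode.simps(2))
  from this[of "[]"] have "foldl (\<lambda>r h. Suc (prod_encode (h, r))) 0 zs = list_encode (rev zs)" for zs
    by simp
  ultimately show ?thesis
    by simp
qed

lemma computable_foldr:
  assumes "computable2 F"
  shows "computable n e1 \<Longrightarrow> computable n e2 \<Longrightarrow> computable n (\<lambda>xs. foldr F (list_decode (e1 xs)) (e2 xs))"
proof -
  assume e: "computable n e1" "computable n e2"
  have "computable2 (\<lambda>r h. F h r)"
    unfolding computable2_def by (rule computable_comp2[OF assms]) (rule comput | simp; fail)+
  then have "computable n (\<lambda>xs. foldl (\<lambda>r h. F h r) (e2 xs) (list_decode (list_encode (rev (list_decode (e1 xs))))))"
    by (rule computable_foldl) (rule e computable_rev)+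
  then show ?thesis
    by (simp add: foldl_conv_foldr)
qed

section \<open>The decision procedure\<close>

lemma word_code_Nil [simp]: "word_code [] = 0"
  by (simp add: word_code_def)

lemma word_code_Cons: "word_code (l # w) = Suc (prod_encode (letter_code l, word_code w))"
  by (simp add: word_code_def)

lemma list_decode_word_code [simp]: "list_decode (word_code w) = map letter_code w"
  by (simp add: word_code_def)

lemma code_hd_word_code [simp]: "code_hd (word_code (l # w)) = letter_code l"
  by (simp add: word_code_Cons code_hd_def)

lemma code_tl_word_code [simp]: "code_tl (word_code (l # w)) = word_code w"
  by (simp add: word_code_Cons code_tl_def)

definition inv_code :: "nat \<Rightarrow> nat" where
  "inv_code x = (if x = 0 then 1 else if x = 1 then 0 else if x = 2 then 3 else 2)"

lemma inv_code_letter_code [simp]: "inv_code (letter_code l) = letter_code (inv_l l)"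
  by (cases l rule: letter_code.cases) (auto simp: inv_code_def inv_l_def)

lemma letter_code_eq_iff [simp]: "letter_code l = letter_code m \<longleftrightarrow> l = m"
  by (cases l rule: letter_code.cases; cases m rule: letter_code.cases) auto

definition cons_code :: "nat \<Rightarrow> nat \<Rightarrow> nat" where
  "cons_code x r = (if r = 0 then Suc (prod_encode (x, 0))
     else if code_hd r = inv_code x then code_tl r else Suc (prod_encode (x, r)))"

lemma cons_code_word_code: "cons_code (letter_code l) (word_code w) = word_code (cons_red l w)"
proof (cases w)
  case (Cons m v)
  have "word_code w \<noteq> 0"
    by (simp add: Cons word_code_Cons)
  then show ?thesis
    using Cons by (simp add: cons_code_def) (simp add: word_code_Cons)
qed (simp add: cons_code_def word_code_Cons)

lemma foldr_word_code:
  assumes "\<And>l z. F (letter_code l) (word_code z) = word_code (G l z)"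
  shows "foldr F (map letter_code w) (word_code z) = word_code (foldr G w z)"
  by (induction w) (auto simp: assms)

definition fl_code :: "nat \<Rightarrow> nat \<Rightarrow> nat" where
  "fl_code l r = (if l = 2 then cons_code 3 r else if l = 3 then cons_code 2 r else cons_code l r)"

definition sg_code :: "nat \<Rightarrow> nat \<Rightarrow> nat" where
  "sg_code l r = (if l = 0 then cons_code 0 (cons_code 2 r)
     else if l = 1 then cons_code 3 (cons_code 1 r) else cons_code l r)"

definition tu_code :: "nat \<Rightarrow> nat \<Rightarrow> nat" where
  "tu_code l r = (if l = 2 then cons_code 2 (cons_code 0 r)
     else if l = 3 then cons_code 1 (cons_code 3 r) else cons_code l r)"

definition move_code :: "nat \<Rightarrow> nat \<Rightarrow> nat" where
  "move_code x h = (if h = 0 then foldr fl_code (list_decode x) 0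
     else if h = 1 then foldr sg_code (list_decode x) 0 else foldr tu_code (list_decode x) 0)"

text \<open>Substitution and reduction happen in a single fold, so a move needs one pass over the
  code.\<close>

lemma reduce_ext_foldr:
  "reduce (ext x y w) = foldr (\<lambda>l z. foldr cons_red (letter_image x y l) z) w []"
  by (induction w) (auto simp: ext_Cons reduce_append)

lemma move_code_word_code: "move_code (word_code w) h = word_code (move h w)"
proof -
  have c: "cons_code 0 (word_code z) = word_code (cons_red (GA, False) z)"
    "cons_code (Suc 0) (word_code z) = word_code (cons_red (GA, True) z)"
    "cons_code 2 (word_code z) = word_code (cons_red (GB, False) z)"
    "cons_code 3 (word_code z) = word_code (cons_red (GB, True) z)" for z
    using cons_code_word_code[of "(GA, False)" z] cons_code_word_code[of "(GA, True)" z]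
      cons_code_word_code[of "(GB, False)" z] cons_code_word_code[of "(GB, True)" z] by simp_all
  have "fl_code (letter_code l) (word_code z) =
      word_code (foldr cons_red (letter_image [(GA, False)] [(GB, True)] l) z)" for l z
    by (cases l rule: letter_code.cases) (simp_all add: fl_code_def c inv_l_def)
  from foldr_word_code[of fl_code, OF this, of w "[]"]
  have fl: "foldr fl_code (map letter_code w) 0 = word_code (reduce (fl w))"
    by (simp add: reduce_ext_foldr)
  have "sg_code (letter_code l) (word_code z) =
      word_code (foldr cons_red (letter_image [(GA, False), (GB, False)] [(GB, False)] l) z)" for l z
    by (cases l rule: letter_code.cases) (simp_all add: sg_code_def c inv_l_def)
  from foldr_word_code[of sg_code, OF this, of w "[]"]
  have sg: "foldr sg_code (map letter_code w) 0 = word_code (reduce (sg w))"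
    by (simp add: reduce_ext_foldr)
  have "tu_code (letter_code l) (word_code z) =
      word_code (foldr cons_red (letter_image [(GA, False)] [(GB, False), (GA, False)] l) z)" for l z
    by (cases l rule: letter_code.cases) (simp_all add: tu_code_def c inv_l_def)
  from foldr_word_code[of tu_code, OF this, of w "[]"]
  have tu: "foldr tu_code (map letter_code w) 0 = word_code (reduce (tu w))"
    by (simp add: reduce_ext_foldr)
  show ?thesis
    by (simp add: move_code_def move_def fl sg tu)
qed

definition moves_code :: "nat \<Rightarrow> nat \<Rightarrow> nat" where
  "moves_code x c = foldl move_code x (list_decode c)"

lemma moves_code_word_code: "moves_code (word_code w) (list_encode c) = word_code (moves c w)"
proof -
  have "foldl move_code (word_code w) c = word_code (moves c w)"
    by (induction c arbitrary: w) (auto simp: move_code_word_code)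
  then show ?thesis
    by (simp add: moves_code_def)
qed

definition length_code :: "nat \<Rightarrow> nat" where
  "length_code x = foldl (\<lambda>r h. Suc r) 0 (list_decode x)"

lemma length_code_word_code: "length_code (word_code w) = length w"
proof -
  have "foldl (\<lambda>r h. Suc r) n xs = n + length xs" for n and xs :: "nat list"
    by (induction xs arbitrary: n) auto
  then show ?thesis
    by (simp add: length_code_def)
qed

text \<open>Folding a reduced word onto itself yields the reduced form of its square, so this is
  \<open>clen_double\<close> solved for the cyclic length.\<close>

definition clen_code :: "nat \<Rightarrow> nat" where
  "clen_code x = length_code (foldr cons_code (list_decode x) x) - length_code x"

lemma clen_code_word_code: "reduced w \<Longrightarrow> clen_code (word_code w) = clen w"
  using clen_double[of w] foldr_word_code[of cons_code cons_red, OF cons_code_word_code, of w w]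
  by (simp add: clen_code_def length_code_word_code reduce_append)

section \<open>Bounded search over test products\<close>

definition moves_bound :: "nat \<Rightarrow> nat" where
  "moves_bound n = rec_nat 0 (\<lambda>_ r. Suc (prod_encode (2, r))) n"

lemma prod_encode_mono: "m \<le> m' \<Longrightarrow> n \<le> n' \<Longrightarrow> prod_encode (m, n) \<le> prod_encode (m', n')"
  unfolding prod_encode_def prod.case by (intro add_mono triangle_mono)

text \<open>The bound is the code of a list of n twos, and the pairing is monotone in both
  arguments.\<close>

lemma list_encode_le_moves_bound:
  "length c \<le> n \<Longrightarrow> set c \<subseteq> {..2} \<Longrightarrow> list_encode c \<le> moves_bound n"
proof (induction c arbitrary: n)
  case (Cons h c)
  then obtain m where "n = Suc m" "length c \<le> m"
    by (cases n) auto
  then show ?case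
    using Cons prod_encode_mono[of h 2 "list_encode c" "moves_bound m"] by (simp add: moves_bound_def)
qed simp

definition disagreements :: "nat \<Rightarrow> nat \<Rightarrow> nat \<Rightarrow> nat" where
  "disagreements m x y = rec_nat 0 (\<lambda>c r. r +
     (if clen_code (moves_code x c) = clen_code (moves_code y c) then 0 else 1)) m"

lemma disagreements_eq_0_iff:
  "disagreements m x y = 0 \<longleftrightarrow> (\<forall>c<m. clen_code (moves_code x c) = clen_code (moves_code y c))"
  by (induction m) (auto simp: disagreements_def less_Suc_eq)

definition decide_code :: "nat \<Rightarrow> nat \<Rightarrow> nat" where
  "decide_code x y = (if disagreements (Suc (moves_bound (4 * x + 4 * y + 2))) x y = 0 then 1 else 0)"

text \<open>Lengths are bounded by codes, so the search reaches all required products. It also meets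
  lists with entries above 2, which \<open>move\<close> reads as \<open>tu\<close>; these are
  automorphisms too and cause no false disagreement.\<close>

lemma decide_code_word_code:
  assumes "u \<in> F2" "v \<in> F2"
  shows "decide_code (word_code u) (word_code v) = (if translation_equivalent u v then 1 else 0)"
proof -
  let ?N = "4 * word_code u + 4 * word_code v + 2"
  have clen: "clen_code (moves_code (word_code w) c) = clen (moves (list_decode c) w)" if "w \<in> F2" for w c
    using moves_code_word_code[of w "list_decode c"] that
    by (simp add: clen_code_word_code reduced_moves F2_def)
  have "translation_equivalent u v \<longleftrightarrow>
      (\<forall>c<Suc (moves_bound ?N). clen (moves (list_decode c) u) = clen (moves (list_decode c) v))"
  proof
    assume "translation_equivalent u v"
    then show "\<forall>c<Suc (moves_bound ?N). clen (moves (list_decode c) u) = clen (moves (list_decode c) v)"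
      using translation_equivalent_imp_moves[OF assms] by blast
  next
    assume *: "\<forall>c<Suc (moves_bound ?N). clen (moves (list_decode c) u) = clen (moves (list_decode c) v)"
    show "translation_equivalent u v"
    proof (rule moves_imp_translation_equivalent[OF assms])
      fix c :: "nat list"
      assume c: "length c \<le> 4 * length u + 4 * length v + 2" "set c \<subseteq> {..2}"
      have "length w \<le> word_code w" for w
        using length_le_list_encode[of "map letter_code w"] by (simp add: word_code_def)
      from this[of u] this[of v] have "length c \<le> ?N"
        using c(1) by linarith
      then have "list_encode c < Suc (moves_bound ?N)"
        using list_encode_le_moves_bound c(2) by (simp add: le_imp_less_Suc)
      then show "clen (moves c u) = clen (moves c v)"
        using *[rule_format, of "list_encode c"] by simp
    qed
  qed
  then show ?thesis
    using assms by (simp add: decide_code_def disagreements_eq_0_iff clen)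
qed

section \<open>Computability of the decision procedure\<close>

lemma computable2_cons_code: "computable2 cons_code"
  unfolding cons_code_def[abs_def] inv_code_def by (rule comput | simp; fail)+

lemmas computable_cons_code [comput] = computable_comp2[OF computable2_cons_code]

lemma computable2_move_code: "computable2 move_code"
proof -
  have "computable2 fl_code" "computable2 sg_code" "computable2 tu_code"
    unfolding fl_code_def[abs_def] sg_code_def[abs_def] tu_code_def[abs_def]
    by (rule comput | simp; fail)+
  note foldr = this[THEN computable_foldr]
  show ?thesis
    unfolding move_code_def[abs_def] by (rule comput foldr | simp; fail)+
qed

lemma computable_moves_code [comput]:
  "computable n e1 \<Longrightarrow> computable n e2 \<Longrightarrow> computable n (\<lambda>xs. moves_code (e1 xs) (e2 xs))"
  unfolding moves_code_def by (rule computable_foldl[OF computable2_move_code])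

lemma computable_clen_code [comput]: "computable n e \<Longrightarrow> computable n (\<lambda>xs. clen_code (e xs))"
proof -
  assume e: "computable n e"
  have "computable2 (\<lambda>r h. Suc r)"
    by (rule comput | simp; fail)+
  note length = computable_foldl[OF this]
  show ?thesis
    unfolding clen_code_def length_code_def
    by (rule comput length computable_foldr[OF computable2_cons_code] e)+
qed

lemma computable2_decide_code: "computable2 decide_code"
proof -
  have "computable2 (\<lambda>_ r. Suc (prod_encode (2, r)))"
    by (rule comput | simp; fail)+
  then have "computable1 moves_bound"
    unfolding moves_bound_def[abs_def] by (rule computable_rec_nat_0)
  note bound = computable_comp1[OF this]
  have "computable3 disagreements"
    unfolding disagreements_def[abs_def]
    by (rule computable_rec_nat_2) (rule comput | simp; fail)+
  note disagreements = computable_comp3[OF this]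
  \<comment> \<open>Rewrites the factor 4 as sums, which \<open>computable_add\<close>
    covers.\<close>
  have four: "4 * x = x + x + (x + x)" for x :: nat
    by simp
  show ?thesis
    unfolding decide_code_def[abs_def] four
    by (rule comput bound disagreements | simp; fail)+
qed

theorem theorem1p2:
  shows "\<exists>p. \<forall>u\<in>F2. \<forall>v\<in>F2.
           rec_eval p [word_code u, word_code v] (if translation_equivalent u v then 1 else 0)"
proof -
  obtain p where p: "rec_eval p xs (decide_code (xs ! 0) (xs ! 1))" if "length xs = 2" for xs
    using computable2_decide_code unfolding computable2_def computable_def by blast
  have "rec_eval p [word_code u, word_code v] (if translation_equivalent u v then 1 else 0)"
    if "u \<in> F2" "v \<in> F2" for u v
    using p[of "[word_code u, word_code v]"] decide_code_word_code[OF that] by simp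
  then show ?thesis
    by blast
qed

end
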